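(* Let $M$ be a proper quasi bi-slant submanifold of a cosymplectic manifold $(\bar M,\varphi,\xi,\eta,g)$, with $TM=\mathcal{D}\oplus\mathcal{D}_1\oplus\mathcal{D}_2\oplus\langle\xi\rangle$. The slant distribution $\mathcal{D}_1$ defines a totally geodesic foliation (in the sense that $\bar\nabla_{U_1}V_1\in\Gamma(\mathcal{D}_1)$ for all $U_1,V_1\in\Gamma(\mathcal{D}_1)$) if and only if $$g(\mathcal{A}_{\mathcal{F}\mathcal{T}V_1}U_1,Z)-g(\mathcal{A}_{\mathcal{F}V_1}U_1,\mathcal{T}\mathcal{P}Z)=g(\mathcal{A}_{\mathcal{F}V_1}U_1,\mathcal{T}\mathcal{R}Z)-g(\nabla^{\perp}_{U_1}\mathcal{F}V_1,\mathcal{F}\mathcal{R}Z)$$ and $$\mathcal{F}\mathcal{A}_{\mathcal{F}V_1}U_1-\nabla^{\perp}_{U_1}\mathcal{F}\mathcal{T}V_1-\mathcal{C}\nabla^{\perp}_{U_1}\mathcal{F}V_1\in\Gamma(TM)$$ (that is, this normal vector field vanishes) for all $U_1,V_1\in\Gamma(\mathcal{D}_1)$ and $Z\in\Gamma(\mathcal{D}\oplus\mathcal{D}_2)$.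
   Context: An almost contact metric manifold $(\bar M,\varphi,\xi,\eta,g)$ is an odd-dimensional smooth manifold with a $(1,1)$-tensor $\varphi$, a vector field $\xi$, a 1-form $\eta$ and a Riemannian metric $g$ such that $\varphi^2=-I+\eta\otimes\xi$, $\varphi\xi=0$, $\eta\circ\varphi=0$, $\eta(\xi)=1$, $g(\varphi X,\varphi Y)=g(X,Y)-\eta(X)\eta(Y)$, $\eta(X)=g(X,\xi)$. It is cosymplectic if $\bar\nabla\varphi=0$, where $\bar\nabla$ is the Levi-Civita connection of $g$; then also $\bar\nabla\xi=0$. Let $M$ be a Riemannian manifold isometrically immersed in $\bar M$ (induced metric also denoted $g$). The induced connection $\nabla$, second fundamental form $h$, shape operators $\mathcal{A}_V$ and normal connection $\nabla^\perp$ are given by $\bar\nabla_XY=\nabla_XY+h(X,Y)$ and $\bar\nabla_XV=-\mathcal{A}_VX+\nabla^\perp_XV$ for $X,Y\in\Gamma(TM)$, $V\in\Gamma(T^\perp M)$. $M$ is a quasi bi-slant submanifold if $\xi$ is tangent to $M$ and there is an orthogonal decomposition $TM=\mathcal{D}\oplus\mathcal{D}_1\oplus\mathcal{D}_2\oplus\langle\xi\rangle$ into distributions such that: $\varphi\mathcal{D}=\mathcal{D}$ ($\mathcal{D}$ is invariant); $\varphi\mathcal{D}_1\perp\mathcal{D}_2$ and $\varphi\mathcal{D}_2\perp\mathcal{D}_1$; and for $i=1,2$ the distribution $\mathcal{D}_i$ is slant with slant angle $\theta_i$, i.e. for every $p\in M$ and every nonzero $X\in(\mathcal{D}_i)_p$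 the angle between $\varphi X$ and $(\mathcal{D}_i)_p$ equals the constant $\theta_i$. It is proper if $\mathcal{D},\mathcal{D}_1,\mathcal{D}_2$ all have nonzero rank and $\theta_1,\theta_2\notin\{0,\frac{\pi}{2}\}$. $\mathcal{P},\mathcal{Q},\mathcal{R}$ denote the orthogonal projections of $TM$ onto $\mathcal{D},\mathcal{D}_1,\mathcal{D}_2$. For $X\in\Gamma(TM)$ write $\varphi X=\mathcal{T}X+\mathcal{F}X$, and for $V\in\Gamma(T^\perp M)$ write $\varphi V=\mathcal{B}V+\mathcal{C}V$, where $\mathcal{T}X,\mathcal{B}V$ are tangent and $\mathcal{F}X,\mathcal{C}V$ are normal to $M$. *)

theory Defs
  imports "HOL-Analysis.Analysis"
begin

text \<open>
  The libraries used here contain neither abstract smooth manifolds nor Riemannian geometry, so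
  the notions needed are defined from scratch.  A manifold is a Hausdorff, second countable type
  together with a smooth atlas modelled on a Euclidean space.
\<close>

section \<open>Smooth manifolds\<close>

text \<open>On an open set of a Euclidean space, membership in \<open>C\<^sup>k\<close> for every \<open>k\<close>.\<close>

primrec Ck_on :: "nat \<Rightarrow> ('a::real_normed_vector \<Rightarrow> 'b::real_normed_vector) \<Rightarrow> 'a set \<Rightarrow> bool" where
  "Ck_on 0 f S \<longleftrightarrow> continuous_on S f"
| "Ck_on (Suc k) f S \<longleftrightarrow>
     f differentiable_on S \<and> (\<forall>v. Ck_on k (\<lambda>x. frechet_derivative f (at x) v) S)"

definition smooth_on :: "('a::real_normed_vector \<Rightarrow> 'b::real_normed_vector) \<Rightarrow> 'a set \<Rightarrow> bool" where
  "smooth_on f S \<longleftrightarrow> (\<forall>k. Ck_on k f S)"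

text \<open>A chart is a pair of its domain and its coordinate map; the coordinate map is arbitrary
  outside the domain.\<close>

type_synonym ('m, 'e) chart = "'m set \<times> ('m \<Rightarrow> 'e)"

abbreviation chart_dom :: "('m, 'e) chart \<Rightarrow> 'm set" where
  "chart_dom c \<equiv> fst c"

abbreviation chart_map :: "('m, 'e) chart \<Rightarrow> 'm \<Rightarrow> 'e" where
  "chart_map c \<equiv> snd c"

definition chart_inv :: "('m, 'e) chart \<Rightarrow> 'e \<Rightarrow> 'm" where
  "chart_inv c = inv_into (chart_dom c) (chart_map c)"

definition is_chart :: "('m::topological_space, 'e::euclidean_space) chart \<Rightarrow> bool" where
  "is_chart c \<longleftrightarrow> open (chart_dom c) \<and> open (chart_map c ` chart_dom c) \<and>
     homeomorphism (chart_dom c) (chart_map c ` chart_dom c) (chart_map c) (chart_inv c)"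

definition smooth_atlas ::
    "('m::{t2_space,second_countable_topology}, 'e::euclidean_space) chart set \<Rightarrow> bool" where
  "smooth_atlas A \<longleftrightarrow>
     (\<forall>c\<in>A. is_chart c) \<and>
     (\<Union>c\<in>A. chart_dom c) = UNIV \<and>
     (\<forall>b\<in>A. \<forall>c\<in>A. smooth_on (chart_map c \<circ> chart_inv b)
                       (chart_map b ` (chart_dom b \<inter> chart_dom c)))"

text \<open>
  For every point \<open>p\<close> a chart \<open>chart_at A p\<close> around \<open>p\<close> is chosen once and for all, and the tangent
  space at \<open>p\<close> is identified with the model space \<open>'e\<close> through this chart: the vector \<open>v :: 'e\<close> at
  \<open>p\<close> stands for the tangent vector with components \<open>v\<close> in \<open>chart_at A p\<close>.  The choice is not
  continuous in \<open>p\<close>, so the smoothness of a vector field is never read off from the function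
  \<open>'m \<Rightarrow> 'e\<close> itself, but from its components in a fixed chart.
\<close>

definition chart_at :: "('m, 'e) chart set \<Rightarrow> 'm \<Rightarrow> ('m, 'e) chart" where
  "chart_at A p = (SOME c. c \<in> A \<and> p \<in> chart_dom c)"

text \<open>The derivative at \<open>p\<close> of a function \<open>h\<close> with values in a vector space, in the direction of the
  tangent vector \<open>u\<close> at \<open>p\<close>.\<close>

definition dir_deriv ::
    "('m, 'e::euclidean_space) chart set \<Rightarrow> ('m \<Rightarrow> 'b::real_normed_vector) \<Rightarrow> 'm \<Rightarrow> 'e \<Rightarrow> 'b" where
  "dir_deriv A h p u =
     frechet_derivative (h \<circ> chart_inv (chart_at A p)) (at (chart_map (chart_at A p) p)) u"

text \<open>The components in the chart \<open>c\<close> of the tangent vector \<open>v\<close> at \<open>p\<close>, and conversely the vector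
  field on the domain of \<open>c\<close> whose components in \<open>c\<close> are constantly \<open>v\<close>.\<close>

definition components ::
    "('m, 'e::euclidean_space) chart set \<Rightarrow> ('m, 'e) chart \<Rightarrow> 'm \<Rightarrow> 'e \<Rightarrow> 'e" where
  "components A c p v = dir_deriv A (chart_map c) p v"

definition coord_field ::
    "('m, 'e::euclidean_space) chart set \<Rightarrow> ('m, 'e) chart \<Rightarrow> 'e \<Rightarrow> 'm \<Rightarrow> 'e" where
  "coord_field A c v p =
     frechet_derivative (chart_map (chart_at A p) \<circ> chart_inv c) (at (chart_map c p)) v"

definition smooth_fun_on ::
    "('m::topological_space, 'e::euclidean_space) chart set \<Rightarrow> 'm set \<Rightarrow>
       ('m \<Rightarrow> 'b::real_normed_vector) \<Rightarrow> bool" where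
  "smooth_fun_on A S h \<longleftrightarrow>
     (\<forall>c\<in>A. smooth_on (h \<circ> chart_inv c) (chart_map c ` (chart_dom c \<inter> S)))"

definition smooth_map ::
    "('a::topological_space, 'd::euclidean_space) chart set \<Rightarrow>
     ('m::topological_space, 'e::euclidean_space) chart set \<Rightarrow> ('a \<Rightarrow> 'm) \<Rightarrow> bool" where
  "smooth_map A B f \<longleftrightarrow>
     continuous_on UNIV f \<and>
     (\<forall>c\<in>B. smooth_fun_on A (f -` chart_dom c) (\<lambda>p. chart_map c (f p)))"

definition tangent_map ::
    "('a, 'd::euclidean_space) chart set \<Rightarrow> ('m, 'e::euclidean_space) chart set \<Rightarrow>
       ('a \<Rightarrow> 'm) \<Rightarrow> 'a \<Rightarrow> 'd \<Rightarrow> 'e" where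
  "tangent_map A B f p u = dir_deriv A (\<lambda>q. chart_map (chart_at B (f p)) (f q)) p u"

text \<open>Smooth vector fields along a map \<open>f\<close>, i.e. smooth local sections of the pull-back under \<open>f\<close> of
  the tangent bundle; vector fields on a manifold are the case of the identity map.\<close>

definition smooth_field_along_on ::
    "('a::topological_space, 'd::euclidean_space) chart set \<Rightarrow>
     ('m::topological_space, 'e::euclidean_space) chart set \<Rightarrow> ('a \<Rightarrow> 'm) \<Rightarrow>
       'a set \<Rightarrow> ('a \<Rightarrow> 'e) \<Rightarrow> bool" where
  "smooth_field_along_on A B f S W \<longleftrightarrow>
     (\<forall>c\<in>B. smooth_fun_on A (S \<inter> f -` chart_dom c) (\<lambda>p. components B c (f p) (W p)))"

abbreviation vector_field_on ::
    "('m::topological_space, 'e::euclidean_space) chart set \<Rightarrow> 'm set \<Rightarrow> ('m \<Rightarrow> 'e) \<Rightarrow> bool" where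
  "vector_field_on A S X \<equiv> smooth_field_along_on A A (\<lambda>p. p) S X"

text \<open>The components of \<open>[X, Y]\<close> at \<open>p\<close> in the chart chosen at \<open>p\<close>, that is
  \<open>X(Y\<^sup>k) - Y(X\<^sup>k)\<close>.\<close>

definition lie_bracket ::
    "('m, 'e::euclidean_space) chart set \<Rightarrow> ('m \<Rightarrow> 'e) \<Rightarrow> ('m \<Rightarrow> 'e) \<Rightarrow> 'm \<Rightarrow> 'e" where
  "lie_bracket A X Y p =
     dir_deriv A (\<lambda>q. components A (chart_at A p) q (Y q)) p (X p)
   - dir_deriv A (\<lambda>q. components A (chart_at A p) q (X q)) p (Y p)"


section \<open>Riemannian metrics and the Levi-Civita connection\<close>

definition riemannian_metric ::
    "('m::topological_space, 'e::euclidean_space) chart set \<Rightarrow> ('m \<Rightarrow> 'e \<Rightarrow> 'e \<Rightarrow> real) \<Rightarrow> bool" where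
  "riemannian_metric A g \<longleftrightarrow>
     (\<forall>p. bilinear (g p)) \<and>
     (\<forall>p v w. g p v w = g p w v) \<and>
     (\<forall>p v. v \<noteq> 0 \<longrightarrow> g p v v > 0) \<and>
     (\<forall>S X Y. open S \<longrightarrow> vector_field_on A S X \<longrightarrow> vector_field_on A S Y \<longrightarrow>
        smooth_fun_on A S (\<lambda>p. g p (X p) (Y p)))"

text \<open>A connection acts on vector fields defined on open sets \<open>S\<close>.  These are represented by total
  functions with arbitrary values outside \<open>S\<close>; the last clause makes the operator local.\<close>

definition affine_connection ::
    "('m::topological_space, 'e::euclidean_space) chart set \<Rightarrow>
       (('m \<Rightarrow> 'e) \<Rightarrow> ('m \<Rightarrow> 'e) \<Rightarrow> 'm \<Rightarrow> 'e) \<Rightarrow> bool" where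
  "affine_connection A nabla \<longleftrightarrow>
     (\<forall>S X Y. open S \<longrightarrow> vector_field_on A S X \<longrightarrow> vector_field_on A S Y \<longrightarrow>
        vector_field_on A S (nabla X Y) \<and>
        (\<forall>Z. vector_field_on A S Z \<longrightarrow> (\<forall>p\<in>S.
           nabla (\<lambda>q. X q + Z q) Y p = nabla X Y p + nabla Z Y p \<and>
           nabla X (\<lambda>q. Y q + Z q) p = nabla X Y p + nabla X Z p)) \<and>
        (\<forall>h :: 'm \<Rightarrow> real. smooth_fun_on A S h \<longrightarrow> (\<forall>p\<in>S.
           nabla (\<lambda>q. h q *\<^sub>R X q) Y p = h p *\<^sub>R nabla X Y p \<and>
           nabla X (\<lambda>q. h q *\<^sub>R Y q) p =
             dir_deriv A h p (X p) *\<^sub>R Y p + h p *\<^sub>R nabla X Y p)) \<and>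
        (\<forall>X' Y'. (\<forall>q\<in>S. X' q = X q \<and> Y' q = Y q) \<longrightarrow> (\<forall>p\<in>S. nabla X' Y' p = nabla X Y p)))"

definition levi_civita ::
    "('m::topological_space, 'e::euclidean_space) chart set \<Rightarrow> ('m \<Rightarrow> 'e \<Rightarrow> 'e \<Rightarrow> real) \<Rightarrow>
       (('m \<Rightarrow> 'e) \<Rightarrow> ('m \<Rightarrow> 'e) \<Rightarrow> 'm \<Rightarrow> 'e) \<Rightarrow> bool" where
  "levi_civita A g nabla \<longleftrightarrow>
     affine_connection A nabla \<and>
     (\<forall>S X Y. open S \<longrightarrow> vector_field_on A S X \<longrightarrow> vector_field_on A S Y \<longrightarrow>
        (\<forall>p\<in>S. nabla X Y p - nabla Y X p = lie_bracket A X Y p)) \<and>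
     (\<forall>S X Y Z. open S \<longrightarrow> vector_field_on A S X \<longrightarrow> vector_field_on A S Y \<longrightarrow>
        vector_field_on A S Z \<longrightarrow>
        (\<forall>p\<in>S. dir_deriv A (\<lambda>q. g q (Y q) (Z q)) p (X p) =
                g p (nabla X Y p) (Z p) + g p (Y p) (nabla X Z p)))"

text \<open>
  The derivative of a vector field \<open>W\<close> along \<open>f\<close> in the direction of a vector field \<open>U\<close> on the
  source, with respect to the pull-back under \<open>f\<close> of the connection \<open>nabla\<close>.  In the chart chosen
  at \<open>f p\<close> it is the usual formula \<open>U(W\<^sup>k) + \<Gamma>\<^sup>k(df(U), W)\<close>.  If \<open>X\<close> and \<open>Y\<close> are vector
  fields on the target with \<open>X \<circ> f = df(U)\<close> and \<open>Y \<circ> f = W\<close>, this is \<open>(nabla X Y) \<circ> f\<close>.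
\<close>

definition christoffel ::
    "('m, 'e::euclidean_space) chart set \<Rightarrow> (('m \<Rightarrow> 'e) \<Rightarrow> ('m \<Rightarrow> 'e) \<Rightarrow> 'm \<Rightarrow> 'e) \<Rightarrow>
       'm \<Rightarrow> 'e \<Rightarrow> 'e \<Rightarrow> 'e" where
  "christoffel B nabla q v w =
     nabla (coord_field B (chart_at B q) v) (coord_field B (chart_at B q) w) q"

definition deriv_along ::
    "('a, 'd::euclidean_space) chart set \<Rightarrow> ('m, 'e::euclidean_space) chart set \<Rightarrow> ('a \<Rightarrow> 'm) \<Rightarrow>
     (('m \<Rightarrow> 'e) \<Rightarrow> ('m \<Rightarrow> 'e) \<Rightarrow> 'm \<Rightarrow> 'e) \<Rightarrow> ('a \<Rightarrow> 'd) \<Rightarrow> ('a \<Rightarrow> 'e) \<Rightarrow> 'a \<Rightarrow> 'e" where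
  "deriv_along A B f nabla U W p =
     dir_deriv A (\<lambda>q. components B (chart_at B (f p)) (f q) (W q)) p (U p)
   + christoffel B nabla (f p) (tangent_map A B f p (U p)) (W p)"


section \<open>Cosymplectic manifolds\<close>

definition almost_contact_metric ::
    "('m::{t2_space,second_countable_topology}, 'e::euclidean_space) chart set \<Rightarrow>
     ('m \<Rightarrow> 'e \<Rightarrow> 'e) \<Rightarrow> ('m \<Rightarrow> 'e) \<Rightarrow> ('m \<Rightarrow> 'e \<Rightarrow> real) \<Rightarrow> ('m \<Rightarrow> 'e \<Rightarrow> 'e \<Rightarrow> real) \<Rightarrow> bool" where
  "almost_contact_metric B \<phi> \<xi> \<eta> g \<longleftrightarrow>
     smooth_atlas B \<and> odd DIM('e) \<and>
     (\<forall>p. linear (\<phi> p)) \<and>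
     (\<forall>S X. open S \<longrightarrow> vector_field_on B S X \<longrightarrow> vector_field_on B S (\<lambda>p. \<phi> p (X p))) \<and>
     vector_field_on B UNIV \<xi> \<and>
     (\<forall>p. linear (\<eta> p)) \<and>
     (\<forall>S X. open S \<longrightarrow> vector_field_on B S X \<longrightarrow> smooth_fun_on B S (\<lambda>p. \<eta> p (X p))) \<and>
     riemannian_metric B g \<and>
     (\<forall>p v. \<phi> p (\<phi> p v) = - v + \<eta> p v *\<^sub>R \<xi> p) \<and>
     (\<forall>p. \<phi> p (\<xi> p) = 0) \<and>
     (\<forall>p v. \<eta> p (\<phi> p v) = 0) \<and>
     (\<forall>p. \<eta> p (\<xi> p) = 1) \<and>
     (\<forall>p v w. g p (\<phi> p v) (\<phi> p w) = g p v w - \<eta> p v * \<eta> p w) \<and>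
     (\<forall>p v. \<eta> p v = g p v (\<xi> p))"

definition cosymplectic ::
    "('m::{t2_space,second_countable_topology}, 'e::euclidean_space) chart set \<Rightarrow>
     ('m \<Rightarrow> 'e \<Rightarrow> 'e) \<Rightarrow> ('m \<Rightarrow> 'e) \<Rightarrow> ('m \<Rightarrow> 'e \<Rightarrow> real) \<Rightarrow> ('m \<Rightarrow> 'e \<Rightarrow> 'e \<Rightarrow> real) \<Rightarrow>
     (('m \<Rightarrow> 'e) \<Rightarrow> ('m \<Rightarrow> 'e) \<Rightarrow> 'm \<Rightarrow> 'e) \<Rightarrow> bool" where
  "cosymplectic B \<phi> \<xi> \<eta> g nabla \<longleftrightarrow>
     almost_contact_metric B \<phi> \<xi> \<eta> g \<and> levi_civita B g nabla \<and>
     (\<forall>S X Y. open S \<longrightarrow> vector_field_on B S X \<longrightarrow> vector_field_on B S Y \<longrightarrow>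
        (\<forall>p\<in>S. nabla X (\<lambda>q. \<phi> q (Y q)) p - \<phi> p (nabla X Y p) = 0))"


section \<open>Isometric immersions\<close>

definition isometric_immersion ::
    "('a::{t2_space,second_countable_topology}, 'd::euclidean_space) chart set \<Rightarrow>
     ('a \<Rightarrow> 'd \<Rightarrow> 'd \<Rightarrow> real) \<Rightarrow>
     ('m::{t2_space,second_countable_topology}, 'e::euclidean_space) chart set \<Rightarrow>
     ('m \<Rightarrow> 'e \<Rightarrow> 'e \<Rightarrow> real) \<Rightarrow> ('a \<Rightarrow> 'm) \<Rightarrow> bool" where
  "isometric_immersion A gM B g f \<longleftrightarrow>
     smooth_atlas A \<and> riemannian_metric A gM \<and>
     smooth_map A B f \<and>
     (\<forall>p. inj (tangent_map A B f p)) \<and>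
     (\<forall>p u v. gM p u v = g (f p) (tangent_map A B f p u) (tangent_map A B f p v))"

text \<open>
  Tangent vectors of the submanifold have type \<open>'d\<close> and are moved into the ambient tangent space by
  \<open>tangent_map\<close>; the tangential part of an ambient vector is given as a vector of type \<open>'d\<close>, its
  normal part as an ambient vector.
\<close>

definition tangential_part ::
    "('a, 'd::euclidean_space) chart set \<Rightarrow> ('m, 'e::euclidean_space) chart set \<Rightarrow>
     ('m \<Rightarrow> 'e \<Rightarrow> 'e \<Rightarrow> real) \<Rightarrow> ('a \<Rightarrow> 'm) \<Rightarrow> 'a \<Rightarrow> 'e \<Rightarrow> 'd" where
  "tangential_part A B g f p v =
     (THE u. \<forall>w. g (f p) (v - tangent_map A B f p u) (tangent_map A B f p w) = 0)"

definition normal_part ::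
    "('a, 'd::euclidean_space) chart set \<Rightarrow> ('m, 'e::euclidean_space) chart set \<Rightarrow>
     ('m \<Rightarrow> 'e \<Rightarrow> 'e \<Rightarrow> real) \<Rightarrow> ('a \<Rightarrow> 'm) \<Rightarrow> 'a \<Rightarrow> 'e \<Rightarrow> 'e" where
  "normal_part A B g f p v = v - tangent_map A B f p (tangential_part A B g f p v)"

text \<open>For a normal field \<open>V\<close>, \<open>shape_operator \<dots> V U\<close> is \<open>\<A>\<^sub>V U\<close>.\<close>

definition shape_operator ::
    "('a, 'd::euclidean_space) chart set \<Rightarrow> ('m, 'e::euclidean_space) chart set \<Rightarrow>
     ('m \<Rightarrow> 'e \<Rightarrow> 'e \<Rightarrow> real) \<Rightarrow> ('a \<Rightarrow> 'm) \<Rightarrow>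
     (('m \<Rightarrow> 'e) \<Rightarrow> ('m \<Rightarrow> 'e) \<Rightarrow> 'm \<Rightarrow> 'e) \<Rightarrow> ('a \<Rightarrow> 'e) \<Rightarrow> ('a \<Rightarrow> 'd) \<Rightarrow> 'a \<Rightarrow> 'd" where
  "shape_operator A B g f nabla V U p =
     - tangential_part A B g f p (deriv_along A B f nabla U V p)"

definition normal_connection ::
    "('a, 'd::euclidean_space) chart set \<Rightarrow> ('m, 'e::euclidean_space) chart set \<Rightarrow>
     ('m \<Rightarrow> 'e \<Rightarrow> 'e \<Rightarrow> real) \<Rightarrow> ('a \<Rightarrow> 'm) \<Rightarrow>
     (('m \<Rightarrow> 'e) \<Rightarrow> ('m \<Rightarrow> 'e) \<Rightarrow> 'm \<Rightarrow> 'e) \<Rightarrow> ('a \<Rightarrow> 'd) \<Rightarrow> ('a \<Rightarrow> 'e) \<Rightarrow> 'a \<Rightarrow> 'e" where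
  "normal_connection A B g f nabla U V p =
     normal_part A B g f p (deriv_along A B f nabla U V p)"

text \<open>\<open>phi_T\<close>, \<open>phi_F\<close> are the tangential and normal parts of \<open>\<phi>\<close> on tangent fields, \<open>phi_C\<close> is the
  normal part of \<open>\<phi>\<close> on normal fields.\<close>

definition phi_T ::
    "('a, 'd::euclidean_space) chart set \<Rightarrow> ('m, 'e::euclidean_space) chart set \<Rightarrow>
     ('m \<Rightarrow> 'e \<Rightarrow> 'e \<Rightarrow> real) \<Rightarrow> ('a \<Rightarrow> 'm) \<Rightarrow> ('m \<Rightarrow> 'e \<Rightarrow> 'e) \<Rightarrow> ('a \<Rightarrow> 'd) \<Rightarrow> 'a \<Rightarrow> 'd" where
  "phi_T A B g f \<phi> X p = tangential_part A B g f p (\<phi> (f p) (tangent_map A B f p (X p)))"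

definition phi_F ::
    "('a, 'd::euclidean_space) chart set \<Rightarrow> ('m, 'e::euclidean_space) chart set \<Rightarrow>
     ('m \<Rightarrow> 'e \<Rightarrow> 'e \<Rightarrow> real) \<Rightarrow> ('a \<Rightarrow> 'm) \<Rightarrow> ('m \<Rightarrow> 'e \<Rightarrow> 'e) \<Rightarrow> ('a \<Rightarrow> 'd) \<Rightarrow> 'a \<Rightarrow> 'e" where
  "phi_F A B g f \<phi> X p = normal_part A B g f p (\<phi> (f p) (tangent_map A B f p (X p)))"

definition phi_C ::
    "('a, 'd::euclidean_space) chart set \<Rightarrow> ('m, 'e::euclidean_space) chart set \<Rightarrow>
     ('m \<Rightarrow> 'e \<Rightarrow> 'e \<Rightarrow> real) \<Rightarrow> ('a \<Rightarrow> 'm) \<Rightarrow> ('m \<Rightarrow> 'e \<Rightarrow> 'e) \<Rightarrow> ('a \<Rightarrow> 'e) \<Rightarrow> 'a \<Rightarrow> 'e" where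
  "phi_C A B g f \<phi> V p = normal_part A B g f p (\<phi> (f p) (V p))"


section \<open>Distributions and quasi bi-slant submanifolds\<close>

text \<open>A smooth distribution of rank \<open>k\<close>: a subspace of every tangent space, locally spanned by \<open>k\<close>
  smooth vector fields.\<close>

definition distribution ::
    "('a::topological_space, 'd::euclidean_space) chart set \<Rightarrow> nat \<Rightarrow> ('a \<Rightarrow> 'd set) \<Rightarrow> bool" where
  "distribution A k D \<longleftrightarrow>
     (\<forall>p. subspace (D p) \<and> dim (D p) = k) \<and>
     (\<forall>p. \<exists>S E. open S \<and> p \<in> S \<and> (\<forall>i<k. vector_field_on A S (E i)) \<and>
        (\<forall>q\<in>S. D q = span ((\<lambda>i. E i q) ` {..<k})))"

definition sections ::
    "('a::topological_space, 'd::euclidean_space) chart set \<Rightarrow> ('a \<Rightarrow> 'd set) \<Rightarrow> ('a \<Rightarrow> 'd) set" where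
  "sections A D = {X. vector_field_on A UNIV X \<and> (\<forall>p. X p \<in> D p)}"

definition orth_proj ::
    "('a \<Rightarrow> 'd \<Rightarrow> 'd \<Rightarrow> real) \<Rightarrow> ('a \<Rightarrow> 'd::euclidean_space set) \<Rightarrow> ('a \<Rightarrow> 'd) \<Rightarrow> 'a \<Rightarrow> 'd" where
  "orth_proj gM D X p = (THE Y. Y \<in> D p \<and> (\<forall>Z\<in>D p. gM p (X p - Y) Z = 0))"

text \<open>Angles with respect to an inner product \<open>b\<close>; the angle between a vector and a subspace is the
  least angle between the vector and the nonzero vectors of the subspace.\<close>

definition angle_between :: "('e \<Rightarrow> 'e \<Rightarrow> real) \<Rightarrow> 'e::real_vector \<Rightarrow> 'e \<Rightarrow> real" where
  "angle_between b v w = arccos (b v w / (sqrt (b v v) * sqrt (b w w)))"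

definition angle_to_subspace :: "('e \<Rightarrow> 'e \<Rightarrow> real) \<Rightarrow> 'e::real_vector \<Rightarrow> 'e set \<Rightarrow> real" where
  "angle_to_subspace b v E = (INF w\<in>E - {0}. angle_between b v w)"

definition slant ::
    "('a, 'd::euclidean_space) chart set \<Rightarrow> ('m, 'e::euclidean_space) chart set \<Rightarrow>
     ('m \<Rightarrow> 'e \<Rightarrow> 'e \<Rightarrow> real) \<Rightarrow> ('a \<Rightarrow> 'm) \<Rightarrow> ('m \<Rightarrow> 'e \<Rightarrow> 'e) \<Rightarrow> ('a \<Rightarrow> 'd set) \<Rightarrow> real \<Rightarrow> bool" where
  "slant A B g f \<phi> D \<theta> \<longleftrightarrow>
     (\<forall>p. \<forall>X\<in>D p. X \<noteq> 0 \<longrightarrow>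
        angle_to_subspace (g (f p)) (\<phi> (f p) (tangent_map A B f p X))
          (tangent_map A B f p ` D p) = \<theta>)"

definition xi_line ::
    "('a, 'd::euclidean_space) chart set \<Rightarrow> ('m, 'e::euclidean_space) chart set \<Rightarrow>
     ('a \<Rightarrow> 'm) \<Rightarrow> ('m \<Rightarrow> 'e) \<Rightarrow> 'a \<Rightarrow> 'd set" where
  "xi_line A B f \<xi> p = {u. tangent_map A B f p u \<in> span {\<xi> (f p)}}"

definition orthogonal_spaces :: "('d \<Rightarrow> 'd \<Rightarrow> real) \<Rightarrow> 'd set \<Rightarrow> 'd set \<Rightarrow> bool" where
  "orthogonal_spaces b E F \<longleftrightarrow> (\<forall>x\<in>E. \<forall>y\<in>F. b x y = 0)"

definition sum_spaces :: "('a \<Rightarrow> 'd::real_vector set) \<Rightarrow> ('a \<Rightarrow> 'd set) \<Rightarrow> 'a \<Rightarrow> 'd set" where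
  "sum_spaces D E p = {x + y |x y. x \<in> D p \<and> y \<in> E p}"

definition quasi_bi_slant ::
    "('a::{t2_space,second_countable_topology}, 'd::euclidean_space) chart set \<Rightarrow>
     ('a \<Rightarrow> 'd \<Rightarrow> 'd \<Rightarrow> real) \<Rightarrow>
     ('m::{t2_space,second_countable_topology}, 'e::euclidean_space) chart set \<Rightarrow>
     ('m \<Rightarrow> 'e \<Rightarrow> 'e \<Rightarrow> real) \<Rightarrow> ('a \<Rightarrow> 'm) \<Rightarrow> ('m \<Rightarrow> 'e \<Rightarrow> 'e) \<Rightarrow> ('m \<Rightarrow> 'e) \<Rightarrow>
     ('a \<Rightarrow> 'd set) \<Rightarrow> ('a \<Rightarrow> 'd set) \<Rightarrow> ('a \<Rightarrow> 'd set) \<Rightarrow> real \<Rightarrow> real \<Rightarrow> bool" where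
  "quasi_bi_slant A gM B g f \<phi> \<xi> D D1 D2 \<theta>1 \<theta>2 \<longleftrightarrow>
     (\<forall>p. \<xi> (f p) \<in> range (tangent_map A B f p)) \<and>
     (\<exists>k. distribution A k D) \<and> (\<exists>k. distribution A k D1) \<and> (\<exists>k. distribution A k D2) \<and>
     (\<forall>p X. \<exists>x\<in>D p. \<exists>y\<in>D1 p. \<exists>z\<in>D2 p. \<exists>t\<in>xi_line A B f \<xi> p. X = x + y + z + t) \<and>
     (\<forall>p. orthogonal_spaces (gM p) (D p) (D1 p) \<and>
          orthogonal_spaces (gM p) (D p) (D2 p) \<and>
          orthogonal_spaces (gM p) (D1 p) (D2 p) \<and>
          orthogonal_spaces (gM p) (D p) (xi_line A B f \<xi> p) \<and>
          orthogonal_spaces (gM p) (D1 p) (xi_line A B f \<xi> p) \<and>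
          orthogonal_spaces (gM p) (D2 p) (xi_line A B f \<xi> p)) \<and>
     (\<forall>p. \<phi> (f p) ` tangent_map A B f p ` D p = tangent_map A B f p ` D p) \<and>
     (\<forall>p. orthogonal_spaces (g (f p)) (\<phi> (f p) ` tangent_map A B f p ` D1 p)
            (tangent_map A B f p ` D2 p)) \<and>
     (\<forall>p. orthogonal_spaces (g (f p)) (\<phi> (f p) ` tangent_map A B f p ` D2 p)
            (tangent_map A B f p ` D1 p)) \<and>
     slant A B g f \<phi> D1 \<theta>1 \<and> slant A B g f \<phi> D2 \<theta>2"

text \<open>Distributions have constant rank, so that nonzero rank means nonzero at every point.\<close>

definition proper_quasi_bi_slant ::
    "('a::{t2_space,second_countable_topology}, 'd::euclidean_space) chart set \<Rightarrow>
     ('a \<Rightarrow> 'd \<Rightarrow> 'd \<Rightarrow> real) \<Rightarrow>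
     ('m::{t2_space,second_countable_topology}, 'e::euclidean_space) chart set \<Rightarrow>
     ('m \<Rightarrow> 'e \<Rightarrow> 'e \<Rightarrow> real) \<Rightarrow> ('a \<Rightarrow> 'm) \<Rightarrow> ('m \<Rightarrow> 'e \<Rightarrow> 'e) \<Rightarrow> ('m \<Rightarrow> 'e) \<Rightarrow>
     ('a \<Rightarrow> 'd set) \<Rightarrow> ('a \<Rightarrow> 'd set) \<Rightarrow> ('a \<Rightarrow> 'd set) \<Rightarrow> real \<Rightarrow> real \<Rightarrow> bool" where
  "proper_quasi_bi_slant A gM B g f \<phi> \<xi> D D1 D2 \<theta>1 \<theta>2 \<longleftrightarrow>
     quasi_bi_slant A gM B g f \<phi> \<xi> D D1 D2 \<theta>1 \<theta>2 \<and>
     (\<forall>p. D p \<noteq> {0} \<and> D1 p \<noteq> {0} \<and> D2 p \<noteq> {0}) \<and>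
     \<theta>1 \<notin> {0, pi / 2} \<and> \<theta>2 \<notin> {0, pi / 2}"

text \<open>A vector field \<open>W\<close> along \<open>f\<close> belongs to \<open>\<Gamma>(E)\<close>, for \<open>E\<close> a family of subspaces of the
  tangent spaces of the submanifold; \<open>\<Gamma>(TM)\<close> is the case \<open>E = (\<lambda>p. UNIV)\<close>.\<close>

definition along_in_sections ::
    "('a::topological_space, 'd::euclidean_space) chart set \<Rightarrow>
     ('m::topological_space, 'e::euclidean_space) chart set \<Rightarrow> ('a \<Rightarrow> 'm) \<Rightarrow>
     ('a \<Rightarrow> 'd set) \<Rightarrow> ('a \<Rightarrow> 'e) \<Rightarrow> bool" where
  "along_in_sections A B f E W \<longleftrightarrow>
     (\<exists>Y\<in>sections A E. \<forall>p. W p = tangent_map A B f p (Y p))"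

definition totally_geodesic_foliation ::
    "('a::topological_space, 'd::euclidean_space) chart set \<Rightarrow>
     ('m::topological_space, 'e::euclidean_space) chart set \<Rightarrow> ('a \<Rightarrow> 'm) \<Rightarrow>
     (('m \<Rightarrow> 'e) \<Rightarrow> ('m \<Rightarrow> 'e) \<Rightarrow> 'm \<Rightarrow> 'e) \<Rightarrow> ('a \<Rightarrow> 'd set) \<Rightarrow> bool" where
  "totally_geodesic_foliation A B f nabla E \<longleftrightarrow>
     (\<forall>U\<in>sections A E. \<forall>V\<in>sections A E.
        along_in_sections A B f E (deriv_along A B f nabla U (\<lambda>p. tangent_map A B f p (V p))))"

end

theory Submission
  imports Defs
begin

text \<open>
  Let \<open>U, V\<close> be sections of \<open>\<D>\<^sub>1\<close> and \<open>W\<close> the ambient derivative of \<open>V\<close> along \<open>U\<close>.  The field \<open>\<eta>(V)\<close>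
  vanishes and \<open>\<phi>\<close> is parallel, so \<open>\<phi>\<^sup>2 W = - W\<close>; in particular \<open>W \<bottom> \<xi>\<close>.  Splitting \<open>\<phi> V = \<T> V + \<F> V\<close> twice
  and using \<open>\<T>\<^sup>2 = - cos\<^sup>2 \<theta>\<^sub>1\<close> on \<open>\<D>\<^sub>1\<close> gives
  \<open>sin\<^sup>2 \<theta>\<^sub>1 W = - \<nabla>\<^sub>U \<F>\<T>V - \<phi> \<nabla>\<^sub>U \<F>V\<close>, where \<open>\<nabla>\<close> is the ambient connection.  The component of the right-hand
  side along \<open>Z\<close> in \<open>\<D> \<oplus> \<D>\<^sub>2\<close> is the difference of the two sides of the first condition, and its normal part
  is the field of the second condition; since \<open>sin \<theta>\<^sub>1 \<noteq> 0\<close>, the two conditions say exactly that \<open>W\<close>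
  is tangent and orthogonal to \<open>\<D> \<oplus> \<D>\<^sub>2\<close>, hence lies in \<open>\<D>\<^sub>1\<close>.
\<close>

section \<open>Smooth functions on open sets\<close>

lemma frechet_derivative_cong_open:
  assumes "open S" "x \<in> S" "\<And>y. y \<in> S \<Longrightarrow> f y = g y"
  shows "frechet_derivative f (at x) = frechet_derivative g (at x)"
proof -
  have "(f has_derivative f') (at x) \<longleftrightarrow> (g has_derivative f') (at x)" for f'
    using has_derivative_transform_within_open[OF _ assms(1,2), of f f' UNIV g]
      has_derivative_transform_within_open[OF _ assms(1,2), of g f' UNIV f] assms(3) by auto
  then show ?thesis by (simp add: frechet_derivative_def)
qed

lemma differentiable_on_openD: "f differentiable_on S \<Longrightarrow> open S \<Longrightarrow> x \<in> S \<Longrightarrow> f differentiable (at x)"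
  by (simp add: differentiable_on_eq_differentiable_at)

lemma frechet_derivativeI: "(f has_derivative f') (at x) \<Longrightarrow> frechet_derivative f (at x) = f'"
  by (metis frechet_derivative_at)

lemma Ck_on_cong:
  assumes "open S" "\<And>x. x \<in> S \<Longrightarrow> f x = g x" "Ck_on k f S"
  shows "Ck_on k g S"
  using assms(2,3)
proof (induction k arbitrary: f g)
  case 0
  then show ?case by (metis Ck_on.simps(1) continuous_on_cong)
next
  case (Suc k)
  have "g differentiable_on S"
    using Suc.prems by (metis Ck_on.simps(2) differentiable_on_def differentiable_transform_within
        zero_less_one)
  moreover have "Ck_on k (\<lambda>x. frechet_derivative g (at x) v) S" for v
  proof (rule Suc.IH)
    show "frechet_derivative f (at x) v = frechet_derivative g (at x) v" if "x \<in> S" for x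
      using frechet_derivative_cong_open[OF assms(1) that Suc.prems(1)] by simp
    show "Ck_on k (\<lambda>x. frechet_derivative f (at x) v) S" using Suc.prems by simp
  qed
  ultimately show ?case by simp
qed

lemma Ck_on_subset: "Ck_on k f S \<Longrightarrow> T \<subseteq> S \<Longrightarrow> Ck_on k f T"
  by (induction k arbitrary: f) (auto intro: continuous_on_subset differentiable_on_subset)

lemma Ck_on_local:
  assumes "open S" "\<And>x. x \<in> S \<Longrightarrow> \<exists>N. open N \<and> x \<in> N \<and> Ck_on k f N"
  shows "Ck_on k f S"
  using assms(2)
proof (induction k arbitrary: f)
  case 0
  then show ?case
    by (metis Ck_on.simps(1) assms(1) continuous_at_imp_continuous_on continuous_on_eq_continuous_at)
next
  case (Suc k)
  have "f differentiable at x" if "x \<in> S" for x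
    using Suc.prems[OF that] differentiable_on_openD by auto
  moreover have "Ck_on k (\<lambda>x. frechet_derivative f (at x) v) S" for v
  proof (rule Suc.IH)
    show "\<exists>N. open N \<and> x \<in> N \<and> Ck_on k (\<lambda>x. frechet_derivative f (at x) v) N" if "x \<in> S" for x
      using Suc.prems[OF that] by auto
  qed
  ultimately show ?case
    using assms(1) by (simp add: differentiable_on_eq_differentiable_at)
qed

lemma Ck_on_SucD: "Ck_on (Suc k) f S \<Longrightarrow> Ck_on k f S"
proof (induction k arbitrary: f)
  case 0
  then show ?case by (simp add: differentiable_imp_continuous_on)
next
  case (Suc k)
  then show ?case by (metis Ck_on.simps(2))
qed

lemma Ck_on_SucI:
  assumes "open S" "\<And>x. x \<in> S \<Longrightarrow> (f has_derivative f' x) (at x)"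
    "\<And>v. Ck_on k (\<lambda>x. f' x v) S"
  shows "Ck_on (Suc k) f S"
proof -
  have "f differentiable_on S"
    using assms(1,2) by (metis differentiable_def differentiable_on_eq_differentiable_at)
  moreover have "Ck_on k (\<lambda>x. frechet_derivative f (at x) v) S" for v
    using frechet_derivativeI[OF assms(2)] by (intro Ck_on_cong[OF assms(1) _ assms(3)]) simp
  ultimately show ?thesis by simp
qed

lemma Ck_on_Suc_has_derivative:
  assumes "Ck_on (Suc k) f S" "open S" "x \<in> S"
  shows "(f has_derivative frechet_derivative f (at x)) (at x)"
  using assms by (metis Ck_on.simps(2) differentiable_on_openD frechet_derivative_works)

lemma Ck_on_const: "Ck_on k (\<lambda>x. a) S"
  by (induction k arbitrary: a) auto

lemma Ck_on_bounded_linear: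
  assumes "bounded_linear L" "open S" "Ck_on k f S"
  shows "Ck_on k (\<lambda>x. L (f x)) S"
  using assms(3)
proof (induction k arbitrary: f)
  case 0
  then show ?case using assms(1) by (simp add: bounded_linear.continuous_on)
next
  case (Suc k)
  show ?case
  proof (rule Ck_on_SucI[OF assms(2)])
    show "((\<lambda>x. L (f x)) has_derivative (\<lambda>v. L (frechet_derivative f (at x) v))) (at x)"
      if "x \<in> S" for x
      by (rule bounded_linear.has_derivative[OF assms(1) Ck_on_Suc_has_derivative[OF Suc.prems assms(2) that]])
    show "Ck_on k (\<lambda>x. L (frechet_derivative f (at x) v)) S" for v
      using Suc by simp
  qed
qed

lemma Ck_on_add:
  assumes "open S" "Ck_on k f S" "Ck_on k g S"
  shows "Ck_on k (\<lambda>x. f x + g x) S"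
  using assms(2,3)
proof (induction k arbitrary: f g)
  case 0
  then show ?case by (simp add: continuous_on_add)
next
  case (Suc k)
  show ?case
  proof (rule Ck_on_SucI[OF assms(1)])
    show "((\<lambda>x. f x + g x) has_derivative
        (\<lambda>v. frechet_derivative f (at x) v + frechet_derivative g (at x) v)) (at x)" if "x \<in> S" for x
      using Suc.prems that assms(1) by (intro has_derivative_add Ck_on_Suc_has_derivative)
  qed (use Suc in simp)
qed

lemma Ck_on_bilinear:
  assumes "bounded_bilinear B" "open S" "Ck_on k f S" "Ck_on k g S"
  shows "Ck_on k (\<lambda>x. B (f x) (g x)) S"
  using assms(3,4)
proof (induction k arbitrary: f g)
  case 0
  then show ?case using assms(1) by (simp add: bounded_bilinear.continuous_on)
next
  case (Suc k)
  show ?case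
  proof (rule Ck_on_SucI[OF assms(2)])
    show "((\<lambda>x. B (f x) (g x)) has_derivative
        (\<lambda>v. B (f x) (frechet_derivative g (at x) v) + B (frechet_derivative f (at x) v) (g x))) (at x)"
      if "x \<in> S" for x
      using Suc.prems that assms(2)
      by (intro bounded_bilinear.FDERIV[OF assms(1)] Ck_on_Suc_has_derivative)
    show "Ck_on k (\<lambda>x. B (f x) (frechet_derivative g (at x) v) + B (frechet_derivative f (at x) v) (g x)) S" for v
      using Suc.prems Ck_on_SucD[OF Suc.prems(1)] Ck_on_SucD[OF Suc.prems(2)]
      by (intro Ck_on_add[OF assms(2)] Suc.IH) auto
  qed
qed

lemma Ck_on_sum:
  assumes "open S" "\<And>i. i \<in> I \<Longrightarrow> Ck_on k (f i) S"
  shows "Ck_on k (\<lambda>x. \<Sum>i\<in>I. f i x) S"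
  using assms(2)
  by (induction I rule: infinite_finite_induct) (auto intro: Ck_on_const Ck_on_add[OF assms(1)])

lemma Ck_on_inverse:
  fixes f :: "'a::real_normed_vector \<Rightarrow> real"
  assumes "open S" "\<And>x. x \<in> S \<Longrightarrow> f x \<noteq> 0" "Ck_on k f S"
  shows "Ck_on k (\<lambda>x. inverse (f x)) S"
  using assms(3)
proof (induction k)
  case 0
  then show ?case using assms(2) by (simp add: continuous_on_inverse)
next
  case (Suc k)
  show ?case
  proof (rule Ck_on_SucI[OF assms(1)])
    show "((\<lambda>x. inverse (f x)) has_derivative
       (\<lambda>v. (-1) *\<^sub>R (inverse (f x) * frechet_derivative f (at x) v * inverse (f x)))) (at x)" if "x \<in> S" for x
      using Deriv.has_derivative_inverse[OF assms(2)[OF that] Ck_on_Suc_has_derivative[OF Suc.prems assms(1) that]]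
      by simp
    show "Ck_on k (\<lambda>x. (-1) *\<^sub>R (inverse (f x) * frechet_derivative f (at x) v * inverse (f x))) S" for v
      using Suc.prems Suc.IH Ck_on_SucD[OF Suc.prems]
      by (intro Ck_on_bounded_linear[OF bounded_linear_scaleR_right] Ck_on_bilinear[OF bounded_bilinear_mult] assms(1))
         auto
  qed
qed

lemma linear_eq_sum_Basis:
  fixes L :: "'a::euclidean_space \<Rightarrow> 'b::real_vector"
  assumes "linear L"
  shows "L v = (\<Sum>b\<in>Basis. (v \<bullet> b) *\<^sub>R L b)"
proof -
  interpret linear L by fact
  have "L v = L (\<Sum>b\<in>Basis. (v \<bullet> b) *\<^sub>R b)" by (simp add: euclidean_representation)
  then show ?thesis by (simp add: sum scale)
qed

lemma Ck_on_compose: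
  fixes f :: "'a::real_normed_vector \<Rightarrow> 'b::euclidean_space"
    and h :: "'b \<Rightarrow> 'c::real_normed_vector"
  assumes "open S" "open T" "f ` S \<subseteq> T" "Ck_on k f S" "Ck_on k h T"
  shows "Ck_on k (\<lambda>x. h (f x)) S"
  using assms(4,5)
proof (induction k arbitrary: h)
  case 0
  then show ?case using assms(3) continuous_on_compose2[of T h S f] by simp
next
  case (Suc k)
  let ?f' = "\<lambda>x. frechet_derivative f (at x)" and ?h' = "\<lambda>y. frechet_derivative h (at y)"
  show ?case
  proof (rule Ck_on_SucI[OF assms(1)])
    show "((\<lambda>x. h (f x)) has_derivative (\<lambda>v. \<Sum>b\<in>Basis. (?f' x v \<bullet> b) *\<^sub>R ?h' (f x) b)) (at x)"
      if "x \<in> S" for x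
    proof -
      have "f x \<in> T" using that assms(3) by auto
      note h' = Ck_on_Suc_has_derivative[OF Suc.prems(2) assms(2) this]
      have "((\<lambda>x. h (f x)) has_derivative (\<lambda>v. ?h' (f x) (?f' x v))) (at x)"
        using diff_chain_at[OF Ck_on_Suc_has_derivative[OF Suc.prems(1) assms(1) that] h']
        by (simp add: o_def)
      moreover have "?h' (f x) w = (\<Sum>b\<in>Basis. (w \<bullet> b) *\<^sub>R ?h' (f x) b)" for w
        by (rule linear_eq_sum_Basis[OF has_derivative_linear[OF h']])
      ultimately show ?thesis by (rule has_derivative_eq_rhs[OF _ ext])
    qed
    show "Ck_on k (\<lambda>x. \<Sum>b\<in>Basis. (?f' x v \<bullet> b) *\<^sub>R ?h' (f x) b) S" for v
    proof (intro Ck_on_sum assms(1) Ck_on_bilinear[OF bounded_bilinear_scaleR])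
      show "Ck_on k (\<lambda>x. ?f' x v \<bullet> b) S" for b
        using Suc.prems(1) by (intro Ck_on_bounded_linear[OF bounded_linear_inner_left] assms(1)) (simp only: Ck_on.simps)
      show "Ck_on k (\<lambda>x. ?h' (f x) b) S" for b
        using Suc.prems(2) by (intro Suc.IH Ck_on_SucD[OF Suc.prems(1)]) (simp only: Ck_on.simps)
    qed
  qed
qed

lemma smooth_on_cong:
  "open S \<Longrightarrow> (\<And>x. x \<in> S \<Longrightarrow> f x = g x) \<Longrightarrow> smooth_on f S \<Longrightarrow> smooth_on g S"
  unfolding smooth_on_def using Ck_on_cong[of S f g] by blast

lemma smooth_on_subset: "smooth_on f S \<Longrightarrow> T \<subseteq> S \<Longrightarrow> smooth_on f T"
  unfolding smooth_on_def using Ck_on_subset by blast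

lemma smooth_on_local:
  assumes "open S" "\<And>x. x \<in> S \<Longrightarrow> \<exists>N. open N \<and> x \<in> N \<and> smooth_on f N"
  shows "smooth_on f S"
  unfolding smooth_on_def
proof
  show "Ck_on k f S" for k
  proof (rule Ck_on_local[OF assms(1)])
    show "\<exists>N. open N \<and> x \<in> N \<and> Ck_on k f N" if "x \<in> S" for x
      using assms(2)[OF that] unfolding smooth_on_def by auto
  qed
qed

lemma smooth_on_const: "smooth_on (\<lambda>x. a) S"
  unfolding smooth_on_def using Ck_on_const by blast

lemma smooth_on_bounded_linear:
  "bounded_linear L \<Longrightarrow> open S \<Longrightarrow> smooth_on f S \<Longrightarrow> smooth_on (\<lambda>x. L (f x)) S"
  unfolding smooth_on_def using Ck_on_bounded_linear[of L S _ f] by blast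

lemma smooth_on_bilinear:
  "bounded_bilinear B \<Longrightarrow> open S \<Longrightarrow> smooth_on f S \<Longrightarrow> smooth_on g S \<Longrightarrow> smooth_on (\<lambda>x. B (f x) (g x)) S"
  unfolding smooth_on_def using Ck_on_bilinear[of B S _ f g] by blast

lemma smooth_on_sum:
  "open S \<Longrightarrow> (\<And>i. i \<in> I \<Longrightarrow> smooth_on (f i) S) \<Longrightarrow> smooth_on (\<lambda>x. \<Sum>i\<in>I. f i x) S"
  unfolding smooth_on_def using Ck_on_sum[of S I _ f] by blast

lemma smooth_on_inverse:
  fixes f :: "'a::real_normed_vector \<Rightarrow> real"
  shows "open S \<Longrightarrow> (\<And>x. x \<in> S \<Longrightarrow> f x \<noteq> 0) \<Longrightarrow> smooth_on f S \<Longrightarrow> smooth_on (\<lambda>x. inverse (f x)) S"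
  unfolding smooth_on_def using Ck_on_inverse[of S f] by blast

lemma smooth_on_compose:
  fixes f :: "'a::real_normed_vector \<Rightarrow> 'b::euclidean_space"
  shows "open S \<Longrightarrow> open T \<Longrightarrow> f ` S \<subseteq> T \<Longrightarrow> smooth_on f S \<Longrightarrow> smooth_on h T \<Longrightarrow> smooth_on (\<lambda>x. h (f x)) S"
  unfolding smooth_on_def using Ck_on_compose[of S T f _ h] by blast

lemma smooth_on_has_derivative:
  "smooth_on f S \<Longrightarrow> open S \<Longrightarrow> x \<in> S \<Longrightarrow> (f has_derivative frechet_derivative f (at x)) (at x)"
  unfolding smooth_on_def by (rule Ck_on_Suc_has_derivative[where k = 0]) auto

lemma smooth_on_derivative:
  assumes "smooth_on f S"
  shows "smooth_on (\<lambda>x. frechet_derivative f (at x) v) S"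
  unfolding smooth_on_def
proof
  show "Ck_on k (\<lambda>x. frechet_derivative f (at x) v) S" for k
    using assms[unfolded smooth_on_def, rule_format, of "Suc k"] by simp
qed

lemma smooth_on_derivative_apply:
  fixes u :: "'a::euclidean_space \<Rightarrow> 'a"
  assumes "open S" "smooth_on f S" "smooth_on u S"
  shows "smooth_on (\<lambda>x. frechet_derivative f (at x) (u x)) S"
proof (rule smooth_on_cong[OF assms(1)])
  show "(\<Sum>b\<in>Basis. (u x \<bullet> b) *\<^sub>R frechet_derivative f (at x) b) = frechet_derivative f (at x) (u x)"
    if "x \<in> S" for x
    by (rule linear_eq_sum_Basis[symmetric])
      (rule has_derivative_linear[OF smooth_on_has_derivative[OF assms(2,1) that]])
  show "smooth_on (\<lambda>x. \<Sum>b\<in>Basis. (u x \<bullet> b) *\<^sub>R frechet_derivative f (at x) b) S"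
    using assms by (intro smooth_on_sum smooth_on_bilinear[OF bounded_bilinear_scaleR]
        smooth_on_bounded_linear[OF bounded_linear_inner_left] smooth_on_derivative)
qed

section \<open>Functions and vector fields on a manifold\<close>

locale manifold =
  fixes A :: "('a::{t2_space,second_countable_topology}, 'd::euclidean_space) chart set"
  assumes atlas: "smooth_atlas A"
begin

lemma
  assumes "c \<in> A"
  shows open_chart_dom: "open (chart_dom c)"
    and chart_inv_map: "p \<in> chart_dom c \<Longrightarrow> chart_inv c (chart_map c p) = p"
    and open_chart_image: "open N \<Longrightarrow> open (chart_map c ` (chart_dom c \<inter> N))"
proof -
  have c: "open (chart_dom c)" "open (chart_map c ` chart_dom c)"
    "homeomorphism (chart_dom c) (chart_map c ` chart_dom c) (chart_map c) (chart_inv c)"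
    using atlas assms by (auto simp: smooth_atlas_def is_chart_def)
  show "open (chart_dom c)" by fact
  show "chart_inv c (chart_map c p) = p" if "p \<in> chart_dom c"
    using c(3) that by (simp add: homeomorphism_def)
  have "openin (top_of_set (chart_map c ` chart_dom c)) (chart_map c ` (chart_dom c \<inter> N))" if "open N"
    using homeomorphism_imp_open_map[OF c(3)] that by (simp add: openin_open_Int)
  then show "open N \<Longrightarrow> open (chart_map c ` (chart_dom c \<inter> N))"
    using c(2) openin_open_trans by blast
qed

lemma chart_at: "chart_at A p \<in> A" "p \<in> chart_dom (chart_at A p)"
proof -
  have "\<exists>c. c \<in> A \<and> p \<in> chart_dom c"
    using atlas UNIV_I[of p] unfolding smooth_atlas_def by (metis UN_iff)
  then have "chart_at A p \<in> A \<and> p \<in> chart_dom (chart_at A p)"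
    unfolding chart_at_def by (rule someI_ex)
  then show "chart_at A p \<in> A" "p \<in> chart_dom (chart_at A p)" by auto
qed

lemma smooth_transition:
  "b \<in> A \<Longrightarrow> c \<in> A \<Longrightarrow> smooth_on (chart_map c \<circ> chart_inv b) (chart_map b ` (chart_dom b \<inter> chart_dom c))"
  using atlas by (simp add: smooth_atlas_def)

lemma smooth_fun_onI:
  assumes S: "open S"
    and h: "\<And>p. p \<in> S \<Longrightarrow> \<exists>c\<in>A. \<exists>N. open N \<and> p \<in> N \<and> p \<in> chart_dom c \<and>
      smooth_on (h \<circ> chart_inv c) (chart_map c ` (chart_dom c \<inter> N))"
  shows "smooth_fun_on A S h"
  unfolding smooth_fun_on_def
proof (intro ballI smooth_on_local)
  fix b assume b: "b \<in> A"
  show "open (chart_map b ` (chart_dom b \<inter> S))" by (rule open_chart_image[OF b S])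
  fix x assume "x \<in> chart_map b ` (chart_dom b \<inter> S)"
  then obtain p where p: "x = chart_map b p" "p \<in> chart_dom b" "p \<in> S" by auto
  obtain c N where c: "c \<in> A" and N: "open N" "p \<in> N" "p \<in> chart_dom c"
    "smooth_on (h \<circ> chart_inv c) (chart_map c ` (chart_dom c \<inter> N))"
    using h[OF p(3)] by auto
  let ?N = "N \<inter> chart_dom c"
  have oN: "open (chart_map b ` (chart_dom b \<inter> ?N))" "open (chart_map c ` (chart_dom c \<inter> N))"
    by (intro open_chart_image open_chart_dom open_Int b c N(1))+
  have "smooth_on (\<lambda>y. (h \<circ> chart_inv c) ((chart_map c \<circ> chart_inv b) y)) (chart_map b ` (chart_dom b \<inter> ?N))"
  proof (rule smooth_on_compose[OF oN _ _ N(4)])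
    show "(chart_map c \<circ> chart_inv b) ` chart_map b ` (chart_dom b \<inter> ?N) \<subseteq> chart_map c ` (chart_dom c \<inter> N)"
      using chart_inv_map[OF b] by force
    show "smooth_on (chart_map c \<circ> chart_inv b) (chart_map b ` (chart_dom b \<inter> ?N))"
      by (rule smooth_on_subset[OF smooth_transition[OF b c]]) auto
  qed
  then have "smooth_on (h \<circ> chart_inv b) (chart_map b ` (chart_dom b \<inter> ?N))"
    by (rule smooth_on_cong[OF oN(1), rotated]) (auto simp: chart_inv_map b c)
  then show "\<exists>N. open N \<and> x \<in> N \<and> smooth_on (h \<circ> chart_inv b) N"
    using oN(1) p N by (intro exI[of _ "chart_map b ` (chart_dom b \<inter> ?N)"]) auto
qed

lemma smooth_fun_onD:
  "smooth_fun_on A S h \<Longrightarrow> c \<in> A \<Longrightarrow> smooth_on (h \<circ> chart_inv c) (chart_map c ` (chart_dom c \<inter> S))"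
  by (simp add: smooth_fun_on_def)

lemma smooth_fun_on_subset: "smooth_fun_on A S h \<Longrightarrow> T \<subseteq> S \<Longrightarrow> smooth_fun_on A T h"
  unfolding smooth_fun_on_def by (meson Int_mono image_mono order_refl smooth_on_subset)

lemma smooth_fun_on_local:
  assumes "open S" "\<And>p. p \<in> S \<Longrightarrow> \<exists>N. open N \<and> p \<in> N \<and> smooth_fun_on A N h"
  shows "smooth_fun_on A S h"
proof (rule smooth_fun_onI[OF assms(1)])
  fix p assume "p \<in> S"
  from assms(2)[OF this] obtain N where N: "open N" "p \<in> N" "smooth_fun_on A N h" by blast
  then show "\<exists>c\<in>A. \<exists>N. open N \<and> p \<in> N \<and> p \<in> chart_dom c \<and>
      smooth_on (h \<circ> chart_inv c) (chart_map c ` (chart_dom c \<inter> N))"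
    using chart_at[of p] smooth_fun_onD[OF N(3)] by (intro bexI[of _ "chart_at A p"] exI[of _ N]) auto
qed

lemma smooth_fun_on_cong:
  assumes "open S" "\<And>p. p \<in> S \<Longrightarrow> h p = k p" "smooth_fun_on A S h"
  shows "smooth_fun_on A S k"
  unfolding smooth_fun_on_def
proof
  fix c assume c: "c \<in> A"
  show "smooth_on (k \<circ> chart_inv c) (chart_map c ` (chart_dom c \<inter> S))"
    by (rule smooth_on_cong[OF open_chart_image[OF c assms(1)] _ smooth_fun_onD[OF assms(3) c]])
       (auto simp: chart_inv_map c assms(2))
qed

lemma smooth_fun_on_const: "smooth_fun_on A S (\<lambda>p. a)"
  by (simp add: smooth_fun_on_def o_def smooth_on_const)

lemma smooth_fun_on_bounded_linear:
  assumes "bounded_linear L" "open S" "smooth_fun_on A S h"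
  shows "smooth_fun_on A S (\<lambda>p. L (h p))"
  using assms smooth_on_bounded_linear[OF assms(1) open_chart_image]
  by (force simp: smooth_fun_on_def o_def)

lemma smooth_fun_on_bilinear:
  assumes "bounded_bilinear B" "open S" "smooth_fun_on A S h" "smooth_fun_on A S k"
  shows "smooth_fun_on A S (\<lambda>p. B (h p) (k p))"
  using assms smooth_on_bilinear[OF assms(1) open_chart_image]
  by (force simp: smooth_fun_on_def o_def)

lemmas smooth_fun_on_mult = smooth_fun_on_bilinear[OF bounded_bilinear_mult]
lemmas smooth_fun_on_scaleR = smooth_fun_on_bilinear[OF bounded_bilinear_scaleR]

lemma smooth_fun_on_inner: "open S \<Longrightarrow> smooth_fun_on A S h \<Longrightarrow> smooth_fun_on A S (\<lambda>p. h p \<bullet> b)"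
  by (rule smooth_fun_on_bounded_linear[OF bounded_linear_inner_left])

lemma smooth_fun_on_sum:
  assumes "open S" "\<And>i. i \<in> I \<Longrightarrow> smooth_fun_on A S (h i)"
  shows "smooth_fun_on A S (\<lambda>p. \<Sum>i\<in>I. h i p)"
  using assms smooth_on_sum[OF open_chart_image[OF _ assms(1)], of _ I]
  by (force simp: smooth_fun_on_def o_def)

lemma smooth_fun_on_add:
  assumes "open S" "smooth_fun_on A S h" "smooth_fun_on A S k"
  shows "smooth_fun_on A S (\<lambda>p. h p + k p)"
  using smooth_fun_on_sum[OF assms(1), of "{True, False}" "\<lambda>b. if b then h else k"] assms(2,3) by simp

lemma smooth_fun_on_diff:
  assumes "open S" "smooth_fun_on A S h" "smooth_fun_on A S k"
  shows "smooth_fun_on A S (\<lambda>p. h p - k p)"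
  using smooth_fun_on_add[OF assms(1,2) smooth_fun_on_bounded_linear[OF bounded_linear_scaleR_right assms(1,3), of "-1"]]
  by simp

lemma smooth_fun_on_inverse:
  fixes h :: "'a \<Rightarrow> real"
  assumes "open S" "smooth_fun_on A S h" "\<And>p. p \<in> S \<Longrightarrow> h p \<noteq> 0"
  shows "smooth_fun_on A S (\<lambda>p. inverse (h p))"
  unfolding smooth_fun_on_def
proof
  fix c assume c: "c \<in> A"
  have "smooth_on (\<lambda>x. inverse ((h \<circ> chart_inv c) x)) (chart_map c ` (chart_dom c \<inter> S))"
    using assms c by (intro smooth_on_inverse open_chart_image smooth_fun_onD) (auto simp: chart_inv_map)
  then show "smooth_on ((\<lambda>p. inverse (h p)) \<circ> chart_inv c) (chart_map c ` (chart_dom c \<inter> S))"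
    by (simp add: o_def)
qed

lemma smooth_chart_map: "c \<in> A \<Longrightarrow> smooth_fun_on A (chart_dom c) (chart_map c)"
  by (simp add: smooth_fun_on_def smooth_transition)

lemma smooth_fun_has_derivative:
  assumes "smooth_fun_on A S h" "open S" "p \<in> S" "c \<in> A" "p \<in> chart_dom c"
  shows "((h \<circ> chart_inv c) has_derivative frechet_derivative (h \<circ> chart_inv c) (at (chart_map c p)))
    (at (chart_map c p))"
  using assms by (intro smooth_on_has_derivative[OF smooth_fun_onD open_chart_image]) auto

lemma has_derivative_dir_deriv:
  assumes "smooth_fun_on A S h" "open S" "p \<in> S"
  shows "((h \<circ> chart_inv (chart_at A p)) has_derivative dir_deriv A h p) (at (chart_map (chart_at A p) p))"
  using smooth_fun_has_derivative[OF assms chart_at] by (simp add: dir_deriv_def[abs_def])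

lemma dir_derivI:
  assumes "((h \<circ> chart_inv (chart_at A p)) has_derivative h') (at (chart_map (chart_at A p) p))"
  shows "dir_deriv A h p u = h' u"
  using frechet_derivativeI[OF assms] by (simp add: dir_deriv_def)

lemma dir_deriv_cong:
  assumes "open S" "p \<in> S" "\<And>q. q \<in> S \<Longrightarrow> h q = k q"
  shows "dir_deriv A h p = dir_deriv A k p"
proof -
  let ?c = "chart_at A p"
  have "frechet_derivative (h \<circ> chart_inv ?c) (at (chart_map ?c p)) = frechet_derivative (k \<circ> chart_inv ?c) (at (chart_map ?c p))"
    by (rule frechet_derivative_cong_open[OF open_chart_image[OF chart_at(1) assms(1)]])
       (auto simp: chart_at chart_inv_map assms)
  then show ?thesis by (simp add: dir_deriv_def[abs_def])
qed

lemma linear_dir_deriv: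
  assumes "smooth_fun_on A S h" "open S" "p \<in> S"
  shows "linear (dir_deriv A h p)"
  using has_derivative_dir_deriv[OF assms] by (rule has_derivative_linear)

lemma chart_change_derivative:
  assumes h: "smooth_fun_on A S h" "open S" "p \<in> S"
    and b: "b \<in> A" "p \<in> chart_dom b" and c: "c \<in> A" "p \<in> chart_dom c"
  shows "frechet_derivative (h \<circ> chart_inv c) (at (chart_map c p)) v =
    frechet_derivative (h \<circ> chart_inv b) (at (chart_map b p))
      (frechet_derivative (chart_map b \<circ> chart_inv c) (at (chart_map c p)) v)"
proof -
  have "((chart_map b \<circ> chart_inv c) has_derivative
      frechet_derivative (chart_map b \<circ> chart_inv c) (at (chart_map c p))) (at (chart_map c p))"
    by (rule smooth_fun_has_derivative[OF smooth_chart_map[OF b(1)] open_chart_dom[OF b(1)] b(2) c])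
  moreover have "((h \<circ> chart_inv b) has_derivative frechet_derivative (h \<circ> chart_inv b) (at (chart_map b p)))
      (at ((chart_map b \<circ> chart_inv c) (chart_map c p)))"
    using smooth_fun_has_derivative[OF h b] by (simp add: chart_inv_map c)
  ultimately have "((h \<circ> chart_inv b) \<circ> (chart_map b \<circ> chart_inv c) has_derivative
     frechet_derivative (h \<circ> chart_inv b) (at (chart_map b p)) \<circ>
     frechet_derivative (chart_map b \<circ> chart_inv c) (at (chart_map c p))) (at (chart_map c p))"
    by (rule diff_chain_at)
  then have "((h \<circ> chart_inv c) has_derivative
     frechet_derivative (h \<circ> chart_inv b) (at (chart_map b p)) \<circ>
     frechet_derivative (chart_map b \<circ> chart_inv c) (at (chart_map c p))) (at (chart_map c p))"
    by (rule has_derivative_transform_within_open[OF _ open_chart_image[OF c(1) open_chart_dom[OF b(1)]]])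
       (auto simp: chart_inv_map b c)
  then show ?thesis by (metis comp_apply frechet_derivativeI)
qed

lemma dir_deriv_chart:
  assumes "smooth_fun_on A S h" "open S" "p \<in> S" "c \<in> A" "p \<in> chart_dom c"
  shows "dir_deriv A h p u = frechet_derivative (h \<circ> chart_inv c) (at (chart_map c p)) (components A c p u)"
  using chart_change_derivative[OF assms chart_at]
  by (simp add: dir_deriv_def components_def)

lemma chart_self_derivative:
  assumes "c \<in> A" "p \<in> chart_dom c"
  shows "frechet_derivative (chart_map c \<circ> chart_inv c) (at (chart_map c p)) v = v"
proof -
  have "((chart_map c \<circ> chart_inv c) has_derivative (\<lambda>v. v)) (at (chart_map c p))"
    using assms by (intro has_derivative_transform_within_open[OF has_derivative_ident
      open_chart_image[OF assms(1) open_UNIV]]) (auto simp: chart_inv_map)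
  then show ?thesis by (simp add: frechet_derivativeI)
qed

lemma
  assumes "c \<in> A" "p \<in> chart_dom c"
  shows linear_components: "linear (components A c p)"
    and linear_coord_field: "linear (\<lambda>v. coord_field A c v p)"
    and components_coord_field: "components A c p (coord_field A c v p) = v"
    and coord_field_components: "coord_field A c (components A c p u) p = u"
proof -
  note sc = smooth_chart_map[OF assms(1)] open_chart_dom[OF assms(1)] assms(2)
  note sa = smooth_chart_map[OF chart_at(1)] open_chart_dom[OF chart_at(1)] chart_at(2)
  show "linear (components A c p)"
    unfolding components_def[abs_def] by (rule linear_dir_deriv[OF sc])
  show "linear (\<lambda>v. coord_field A c v p)"
    unfolding coord_field_def using smooth_fun_has_derivative[OF sa[of p] assms] by (rule has_derivative_linear)
  show "components A c p (coord_field A c v p) = v"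
    using chart_change_derivative[OF sc chart_at assms] chart_self_derivative[OF assms]
    by (simp add: components_def dir_deriv_def coord_field_def)
  show "coord_field A c (components A c p u) p = u"
    using chart_change_derivative[OF sa assms chart_at] chart_self_derivative[OF chart_at]
    by (simp add: components_def dir_deriv_def coord_field_def)
qed

lemma components_chart_at: "components A (chart_at A p) p v = v"
  using chart_self_derivative[OF chart_at] by (simp add: components_def dir_deriv_def)

lemma coord_field_chart_at: "coord_field A (chart_at A p) v p = v"
  using chart_self_derivative[OF chart_at] by (simp add: coord_field_def)

lemma dir_deriv_sum_scaleR:
  assumes "open S" "p \<in> S" "\<And>i. i \<in> I \<Longrightarrow> smooth_fun_on A S (w i)" "\<And>i. i \<in> I \<Longrightarrow> smooth_fun_on A S (h i)"
  shows "dir_deriv A (\<lambda>q. \<Sum>i\<in>I. w i q *\<^sub>R h i q) p u =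
    (\<Sum>i\<in>I. dir_deriv A (w i) p u *\<^sub>R h i p + w i p *\<^sub>R dir_deriv A (h i) p u)"
proof -
  let ?c = "chart_at A p" and ?x = "chart_map (chart_at A p) p"
  have p: "chart_inv ?c ?x = p" by (simp add: chart_inv_map chart_at)
  have "((\<lambda>x. \<Sum>i\<in>I. (w i \<circ> chart_inv ?c) x *\<^sub>R (h i \<circ> chart_inv ?c) x) has_derivative
    (\<lambda>u. \<Sum>i\<in>I. (w i \<circ> chart_inv ?c) ?x *\<^sub>R dir_deriv A (h i) p u + dir_deriv A (w i) p u *\<^sub>R (h i \<circ> chart_inv ?c) ?x)) (at ?x)"
    using assms by (intro has_derivative_sum bounded_bilinear.FDERIV[OF bounded_bilinear_scaleR]
        has_derivative_dir_deriv) auto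
  then show ?thesis
    by (intro dir_derivI) (simp add: o_def p add.commute)
qed

lemma dir_deriv_add:
  assumes "open S" "p \<in> S" "smooth_fun_on A S h" "smooth_fun_on A S k"
  shows "dir_deriv A (\<lambda>q. h q + k q) p u = dir_deriv A h p u + dir_deriv A k p u"
  using has_derivative_add[OF has_derivative_dir_deriv[OF assms(3,1,2)] has_derivative_dir_deriv[OF assms(4,1,2)]]
  by (intro dir_derivI) (simp add: o_def)

lemma dir_deriv_bounded_linear:
  assumes "bounded_linear L" "open S" "p \<in> S" "smooth_fun_on A S h"
  shows "dir_deriv A (\<lambda>q. L (h q)) p u = L (dir_deriv A h p u)"
  using bounded_linear.has_derivative[OF assms(1) has_derivative_dir_deriv[OF assms(4,2,3)]]
  by (intro dir_derivI) (simp add: o_def)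

end

section \<open>Smooth maps and vector fields along them\<close>

lemma (in manifold) smooth_components:
  "vector_field_on A S X \<Longrightarrow> c \<in> A \<Longrightarrow> smooth_fun_on A (S \<inter> chart_dom c) (\<lambda>p. components A c p (X p))"
  by (simp add: smooth_field_along_on_def)

lemma (in manifold) vector_field_on_subset:
  assumes "vector_field_on A S X" "T \<subseteq> S"
  shows "vector_field_on A T X"
  using assms unfolding smooth_field_along_on_def
  by (auto intro: smooth_fun_on_subset[OF _ Int_mono])

lemma (in manifold) smooth_dir_deriv:
  assumes S: "open S" and h: "smooth_fun_on A S h" and U: "vector_field_on A S U"
  shows "smooth_fun_on A S (\<lambda>p. dir_deriv A h p (U p))"
  unfolding smooth_fun_on_def
proof
  fix c assume c: "c \<in> A"
  let ?V = "chart_map c ` (chart_dom c \<inter> S)"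
  have V: "open ?V" by (rule open_chart_image[OF c S])
  have "smooth_on ((\<lambda>p. components A c p (U p)) \<circ> chart_inv c) ?V"
    using smooth_fun_onD[OF smooth_components[OF U c] c] by (simp add: ac_simps)
  then have "smooth_on (\<lambda>x. frechet_derivative (h \<circ> chart_inv c) (at x)
      (((\<lambda>p. components A c p (U p)) \<circ> chart_inv c) x)) ?V"
    by (rule smooth_on_derivative_apply[OF V smooth_fun_onD[OF h c]])
  then show "smooth_on ((\<lambda>p. dir_deriv A h p (U p)) \<circ> chart_inv c) ?V"
    by (rule smooth_on_cong[OF V, rotated])
       (use c in \<open>auto simp: chart_inv_map dir_deriv_chart[OF h S]\<close>)
qed

lemma (in manifold) coord_field_expansion:
  assumes "c \<in> A" "p \<in> chart_dom c"
  shows "v = (\<Sum>b\<in>Basis. (components A c p v \<bullet> b) *\<^sub>R coord_field A c b p)"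
  using linear_eq_sum_Basis[OF linear_coord_field[OF assms]] coord_field_components[OF assms] by metis

lemma (in manifold) vector_field_coord_field:
  assumes c: "c \<in> A"
  shows "vector_field_on A (chart_dom c) (coord_field A c v)"
  unfolding smooth_field_along_on_def vimage_ident
proof (rule ballI)
  fix b assume b: "b \<in> A"
  let ?S = "chart_dom c \<inter> chart_dom b"
  have S: "open ?S" using open_chart_dom b c by blast
  show "smooth_fun_on A ?S (\<lambda>p. components A b p (coord_field A c v p))"
  proof (rule smooth_fun_onI[OF S])
    fix p assume p: "p \<in> ?S"
    have oV: "open (chart_map c ` (chart_dom c \<inter> ?S))" by (rule open_chart_image[OF c S])
    have sm: "smooth_on (chart_map b \<circ> chart_inv c) (chart_map c ` (chart_dom c \<inter> ?S))"
      by (rule smooth_on_subset[OF smooth_transition[OF c b]]) auto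
    have "frechet_derivative (chart_map b \<circ> chart_inv c) (at x) v =
         ((\<lambda>p. components A b p (coord_field A c v p)) \<circ> chart_inv c) x"
      if "x \<in> chart_map c ` (chart_dom c \<inter> ?S)" for x
    proof -
      obtain q where q: "x = chart_map c q" "q \<in> chart_dom c" "q \<in> chart_dom b" using \<open>x \<in> _\<close> by auto
      have "components A b q (coord_field A c v q) = frechet_derivative (chart_map b \<circ> chart_inv c) (at (chart_map c q)) v"
        using dir_deriv_chart[OF smooth_chart_map[OF b] open_chart_dom[OF b] q(3) c q(2)]
          components_coord_field[OF c q(2)]
        by (simp add: components_def)
      then show ?thesis using q by (simp add: chart_inv_map c)
    qed
    from smooth_on_cong[OF oV this smooth_on_derivative[OF sm]]
    have "smooth_on ((\<lambda>p. components A b p (coord_field A c v p)) \<circ> chart_inv c) (chart_map c ` (chart_dom c \<inter> ?S))"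
      by blast
    then show "\<exists>a\<in>A. \<exists>N. open N \<and> p \<in> N \<and> p \<in> chart_dom a \<and>
      smooth_on ((\<lambda>p. components A b p (coord_field A c v p)) \<circ> chart_inv a) (chart_map a ` (chart_dom a \<inter> N))"
      using S c p by (intro bexI[of _ c] exI[of _ ?S]) auto
  qed
qed

locale manifold_map = source: manifold A + target: manifold B
  for A :: "('a::{t2_space,second_countable_topology}, 'd::euclidean_space) chart set"
    and B :: "('m::{t2_space,second_countable_topology}, 'e::euclidean_space) chart set" +
  fixes f :: "'a \<Rightarrow> 'm"
  assumes smooth_f: "smooth_map A B f"
begin

abbreviation df :: "'a \<Rightarrow> 'd \<Rightarrow> 'e" where "df \<equiv> tangent_map A B f"

abbreviation field_along :: "'a set \<Rightarrow> ('a \<Rightarrow> 'e) \<Rightarrow> bool" where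
  "field_along \<equiv> smooth_field_along_on A B f"

lemma open_vimage_f: "open T \<Longrightarrow> open (f -` T)"
  using smooth_f by (simp add: smooth_map_def continuous_on_open_vimage)

lemma smooth_chart_f: "c \<in> B \<Longrightarrow> smooth_fun_on A (f -` chart_dom c) (\<lambda>p. chart_map c (f p))"
  using smooth_f by (simp add: smooth_map_def)

lemma smooth_fun_on_pullback:
  assumes T: "open T" and h: "smooth_fun_on B T h"
  shows "smooth_fun_on A (f -` T) (\<lambda>p. h (f p))"
proof (rule source.smooth_fun_onI[OF open_vimage_f[OF T]])
  fix p assume p: "p \<in> f -` T"
  let ?a = "chart_at A p" and ?b = "chart_at B (f p)"
  let ?N = "f -` (T \<inter> chart_dom ?b)"
  have N: "open ?N" using T target.open_chart_dom[OF target.chart_at(1)] by (intro open_vimage_f open_Int)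
  have oN: "open (chart_map ?a ` (chart_dom ?a \<inter> ?N))"
    by (rule source.open_chart_image[OF source.chart_at(1) N])
  have "smooth_on (\<lambda>x. (h \<circ> chart_inv ?b) (((\<lambda>p. chart_map ?b (f p)) \<circ> chart_inv ?a) x)) (chart_map ?a ` (chart_dom ?a \<inter> ?N))"
  proof (rule smooth_on_compose[OF oN target.open_chart_image[OF target.chart_at(1) T]])
    show "((\<lambda>p. chart_map ?b (f p)) \<circ> chart_inv ?a) ` chart_map ?a ` (chart_dom ?a \<inter> ?N) \<subseteq> chart_map ?b ` (chart_dom ?b \<inter> T)"
      using source.chart_inv_map[OF source.chart_at(1)] by force
    show "smooth_on ((\<lambda>p. chart_map ?b (f p)) \<circ> chart_inv ?a) (chart_map ?a ` (chart_dom ?a \<inter> ?N))"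
      by (rule smooth_on_subset[OF source.smooth_fun_onD[OF smooth_chart_f[OF target.chart_at(1)] source.chart_at(1)]]) auto
    show "smooth_on (h \<circ> chart_inv ?b) (chart_map ?b ` (chart_dom ?b \<inter> T))"
      by (rule target.smooth_fun_onD[OF h target.chart_at(1)])
  qed
  then have "smooth_on ((\<lambda>p. h (f p)) \<circ> chart_inv ?a) (chart_map ?a ` (chart_dom ?a \<inter> ?N))"
    by (rule smooth_on_cong[OF oN, rotated]) (auto simp: source.chart_inv_map target.chart_inv_map source.chart_at target.chart_at)
  then show "\<exists>c\<in>A. \<exists>N. open N \<and> p \<in> N \<and> p \<in> chart_dom c \<and>
      smooth_on ((\<lambda>p. h (f p)) \<circ> chart_inv c) (chart_map c ` (chart_dom c \<inter> N))"
    using N p by (intro bexI[of _ ?a] exI[of _ ?N]) (auto simp: source.chart_at target.chart_at)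
qed

lemma tangent_map_has_derivative:
  "(((\<lambda>q. chart_map (chart_at B (f p)) (f q)) \<circ> chart_inv (chart_at A p)) has_derivative df p)
     (at (chart_map (chart_at A p) p))"
  using source.has_derivative_dir_deriv[OF smooth_chart_f[OF target.chart_at(1)]
      open_vimage_f[OF target.open_chart_dom[OF target.chart_at(1)]], of p "f p"] target.chart_at(2)
  by (simp add: tangent_map_def[abs_def])

lemma linear_df: "linear (df p)"
  using tangent_map_has_derivative by (rule has_derivative_linear)

lemma dir_deriv_pullback:
  assumes T: "open T" "f p \<in> T" and h: "smooth_fun_on B T h"
  shows "dir_deriv A (\<lambda>q. h (f q)) p u = dir_deriv B h (f p) (df p u)"
proof -
  let ?a = "chart_at A p" and ?b = "chart_at B (f p)"
  let ?k = "(\<lambda>q. chart_map ?b (f q)) \<circ> chart_inv ?a"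
  have "((h \<circ> chart_inv ?b) has_derivative dir_deriv B h (f p)) (at (?k (chart_map ?a p)))"
    using target.has_derivative_dir_deriv[OF h T] by (simp add: source.chart_inv_map source.chart_at)
  from diff_chain_at[OF tangent_map_has_derivative this]
  have "((h \<circ> chart_inv ?b) \<circ> ?k has_derivative dir_deriv B h (f p) \<circ> df p) (at (chart_map ?a p))" .
  then have "((\<lambda>q. h (f q)) \<circ> chart_inv ?a has_derivative dir_deriv B h (f p) \<circ> df p) (at (chart_map ?a p))"
    by (rule has_derivative_transform_within_open[OF _ source.open_chart_image[OF source.chart_at(1)[of p]
            open_vimage_f[OF target.open_chart_dom[OF target.chart_at(1)[of "f p"]]]]])
       (auto simp: source.chart_inv_map target.chart_inv_map source.chart_at target.chart_at)
  from source.dir_derivI[OF this] show ?thesis by simp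
qed

lemma components_tangent_map:
  assumes "c \<in> B" "f p \<in> chart_dom c"
  shows "components B c (f p) (df p u) = dir_deriv A (\<lambda>q. chart_map c (f q)) p u"
  using dir_deriv_pullback[OF target.open_chart_dom[OF assms(1)] assms(2) target.smooth_chart_map[OF assms(1)]]
  by (simp add: components_def)

lemma field_along_components:
  "field_along S W \<Longrightarrow> c \<in> B \<Longrightarrow> smooth_fun_on A (S \<inter> f -` chart_dom c) (\<lambda>p. components B c (f p) (W p))"
  by (simp add: smooth_field_along_on_def)

lemma open_Int_vimage_chart: "open S \<Longrightarrow> c \<in> B \<Longrightarrow> open (S \<inter> f -` chart_dom c)"
  by (intro open_Int open_vimage_f target.open_chart_dom)

lemma field_along_subset: "field_along S W \<Longrightarrow> T \<subseteq> S \<Longrightarrow> field_along T W"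
  unfolding smooth_field_along_on_def
  by (auto intro: source.smooth_fun_on_subset[OF _ Int_mono])

lemma field_along_cong:
  assumes "open S" "\<And>p. p \<in> S \<Longrightarrow> W p = W' p" "field_along S W"
  shows "field_along S W'"
  unfolding smooth_field_along_on_def
proof
  fix c assume c: "c \<in> B"
  show "smooth_fun_on A (S \<inter> f -` chart_dom c) (\<lambda>p. components B c (f p) (W' p))"
    by (rule source.smooth_fun_on_cong[OF open_Int_vimage_chart[OF assms(1) c] _ field_along_components[OF assms(3) c]])
       (simp add: assms(2))
qed

lemma field_along_local:
  assumes "open S" "\<And>p. p \<in> S \<Longrightarrow> \<exists>N. open N \<and> p \<in> N \<and> field_along N W"
  shows "field_along S W"
  unfolding smooth_field_along_on_def
proof
  fix c assume c: "c \<in> B"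
  show "smooth_fun_on A (S \<inter> f -` chart_dom c) (\<lambda>p. components B c (f p) (W p))"
  proof (rule source.smooth_fun_on_local[OF open_Int_vimage_chart[OF assms(1) c]])
    fix p assume p: "p \<in> S \<inter> f -` chart_dom c"
    with assms(2) obtain N where "open N" "p \<in> N" "field_along N W" by blast
    with p c show "\<exists>N. open N \<and> p \<in> N \<and> smooth_fun_on A N (\<lambda>p. components B c (f p) (W p))"
      by (intro exI[of _ "N \<inter> f -` chart_dom c"]) (auto intro: open_Int_vimage_chart field_along_components)
  qed
qed

lemma field_along_sum_scaleR:
  assumes "open S" "\<And>i. i \<in> I \<Longrightarrow> smooth_fun_on A S (w i)" "\<And>i. i \<in> I \<Longrightarrow> field_along S (W i)"
  shows "field_along S (\<lambda>p. \<Sum>i\<in>I. w i p *\<^sub>R W i p)"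
  unfolding smooth_field_along_on_def
proof
  fix c assume c: "c \<in> B"
  let ?S = "S \<inter> f -` chart_dom c"
  have S: "open ?S" by (rule open_Int_vimage_chart[OF assms(1) c])
  have "smooth_fun_on A ?S (\<lambda>p. \<Sum>i\<in>I. w i p *\<^sub>R components B c (f p) (W i p))"
    using assms c by (intro source.smooth_fun_on_sum source.smooth_fun_on_scaleR S field_along_components)
      (auto intro: source.smooth_fun_on_subset)
  then show "smooth_fun_on A ?S (\<lambda>p. components B c (f p) (\<Sum>i\<in>I. w i p *\<^sub>R W i p))"
    by (rule source.smooth_fun_on_cong[OF S, rotated])
       (simp add: linear_sum[OF target.linear_components] linear_cmul[OF target.linear_components] c)
qed

lemma field_along_scaleR:
  assumes "open S" "smooth_fun_on A S w" "field_along S W"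
  shows "field_along S (\<lambda>p. w p *\<^sub>R W p)"
  using field_along_sum_scaleR[OF assms(1), of "{()}" "\<lambda>_. w" "\<lambda>_. W"] assms(2,3) by simp

lemma field_along_add:
  assumes "open S" "field_along S W" "field_along S W'"
  shows "field_along S (\<lambda>p. W p + W' p)"
proof -
  have "field_along S (if b then W else W')" for b
    using assms(2,3) by simp
  then show ?thesis
    using field_along_sum_scaleR[OF assms(1), of "{True, False}" "\<lambda>_ _. 1" "\<lambda>b. if b then W else W'"]
      source.smooth_fun_on_const[of S "1::real"] by simp
qed

lemma field_along_diff:
  assumes "open S" "field_along S W" "field_along S W'"
  shows "field_along S (\<lambda>p. W p - W' p)"
  using field_along_add[OF assms(1,2) field_along_scaleR[OF assms(1) source.smooth_fun_on_const assms(3), of "-1"]]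
  by simp

lemma field_along_pullback:
  assumes "open T" "vector_field_on B T Y"
  shows "field_along (f -` T) (\<lambda>p. Y (f p))"
  unfolding smooth_field_along_on_def
proof
  fix c assume c: "c \<in> B"
  have "smooth_fun_on A (f -` (T \<inter> chart_dom c)) (\<lambda>p. components B c (f p) (Y (f p)))"
    using assms c by (intro smooth_fun_on_pullback target.smooth_components open_Int target.open_chart_dom)
  then show "smooth_fun_on A (f -` T \<inter> f -` chart_dom c) (\<lambda>p. components B c (f p) (Y (f p)))"
    by (simp add: vimage_Int)
qed

lemma field_along_pushforward:
  assumes S: "open S" and V: "vector_field_on A S V"
  shows "field_along S (\<lambda>p. df p (V p))"
  unfolding smooth_field_along_on_def
proof
  fix c assume c: "c \<in> B"
  let ?S = "S \<inter> f -` chart_dom c"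
  have oS: "open ?S" by (rule open_Int_vimage_chart[OF S c])
  have VS: "vector_field_on A ?S V"
    by (rule source.vector_field_on_subset[OF V]) simp
  have "smooth_fun_on A ?S (\<lambda>p. dir_deriv A (\<lambda>q. chart_map c (f q)) p (V p))"
    by (rule source.smooth_dir_deriv[OF oS source.smooth_fun_on_subset[OF smooth_chart_f[OF c]] VS]) auto
  then show "smooth_fun_on A ?S (\<lambda>p. components B c (f p) (df p (V p)))"
    by (rule source.smooth_fun_on_cong[OF oS, rotated]) (simp add: components_tangent_map c)
qed

text \<open>Every field along \<open>f\<close> is locally a combination of pulled-back coordinate fields, which reduces
  statements about fields along \<open>f\<close> to statements about vector fields on the target.\<close>

lemma field_along_expansion:
  assumes "c \<in> B" "field_along S W"
  shows "\<And>p. f p \<in> chart_dom c \<Longrightarrow> W p = (\<Sum>b\<in>Basis. (components B c (f p) (W p) \<bullet> b) *\<^sub>R coord_field B c b (f p))"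
    and "open S \<Longrightarrow> smooth_fun_on A (S \<inter> f -` chart_dom c) (\<lambda>p. components B c (f p) (W p) \<bullet> b)"
  using target.coord_field_expansion[OF assms(1)]
    source.smooth_fun_on_inner[OF open_Int_vimage_chart field_along_components[OF assms(2)]] assms(1) by auto

lemma smooth_metric_along:
  assumes g: "riemannian_metric B g" and S: "open S" and W: "field_along S W" "field_along S W'"
  shows "smooth_fun_on A S (\<lambda>p. g (f p) (W p) (W' p))"
proof (rule source.smooth_fun_on_local[OF S])
  fix p assume p: "p \<in> S"
  let ?c = "chart_at B (f p)"
  let ?S = "S \<inter> f -` chart_dom ?c"
  note c = target.chart_at(1)[of "f p"]
  have oS: "open ?S" by (rule open_Int_vimage_chart[OF S c])
  have gs: "smooth_fun_on B (chart_dom ?c) (\<lambda>q. g q (coord_field B ?c a q) (coord_field B ?c b q))" for a b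
    using g target.open_chart_dom[OF c] target.vector_field_coord_field[OF c] by (simp add: riemannian_metric_def)
  let ?w = "\<lambda>W p. components B ?c (f p) (W p)"
  have "smooth_fun_on A ?S (\<lambda>p. \<Sum>a\<in>Basis. \<Sum>b\<in>Basis. (?w W p \<bullet> a) * ((?w W' p \<bullet> b) *
     g (f p) (coord_field B ?c a (f p)) (coord_field B ?c b (f p))))"
    using smooth_fun_on_pullback[OF target.open_chart_dom[OF c] gs]
    by (intro source.smooth_fun_on_sum source.smooth_fun_on_mult oS field_along_expansion(2)[OF c] W S)
       (auto intro: source.smooth_fun_on_subset)
  then have "smooth_fun_on A ?S (\<lambda>p. g (f p) (W p) (W' p))"
  proof (rule source.smooth_fun_on_cong[OF oS, rotated])
    fix q assume q: "q \<in> ?S"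
    have "bilinear (g (f q))" using g by (simp add: riemannian_metric_def)
    then have lin: "linear (g (f q) u)" "linear (\<lambda>u. g (f q) u v)" for u v by (auto simp: bilinear_def)
    have "g (f q) (W q) (W' q) = g (f q) (\<Sum>a\<in>Basis. (?w W q \<bullet> a) *\<^sub>R coord_field B ?c a (f q))
       (\<Sum>b\<in>Basis. (?w W' q \<bullet> b) *\<^sub>R coord_field B ?c b (f q))"
      using field_along_expansion(1)[OF c W(1), of q] field_along_expansion(1)[OF c W(2), of q] q by simp
    also have "\<dots> = (\<Sum>a\<in>Basis. \<Sum>b\<in>Basis. (?w W q \<bullet> a) * ((?w W' q \<bullet> b) *
     g (f q) (coord_field B ?c a (f q)) (coord_field B ?c b (f q))))"
      by (subst sum.swap) (simp add: linear_sum[OF lin(1)] linear_cmul[OF lin(1)] linear_sum[OF lin(2)]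
          linear_cmul[OF lin(2)] sum_distrib_left mult.left_commute)
    finally show "(\<Sum>a\<in>Basis. \<Sum>b\<in>Basis. (?w W q \<bullet> a) * ((?w W' q \<bullet> b) *
     g (f q) (coord_field B ?c a (f q)) (coord_field B ?c b (f q)))) = g (f q) (W q) (W' q)" by simp
  qed
  then show "\<exists>N. open N \<and> p \<in> N \<and> smooth_fun_on A N (\<lambda>p. g (f p) (W p) (W' p))"
    using oS p target.chart_at(2) by blast
qed

end

lemma (in manifold) manifold_map_id: "manifold_map A A (\<lambda>p. p)"
  by unfold_locales (simp add: smooth_map_def continuous_on_id smooth_chart_map)

section \<open>The pull-back connection\<close>

context manifold
begin

lemmas vector_field_sum_scaleR = manifold_map.field_along_sum_scaleR[OF manifold_map_id]
lemmas vector_field_cong = manifold_map.field_along_cong[OF manifold_map_id]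
lemmas vector_field_diff = manifold_map.field_along_diff[OF manifold_map_id]
lemmas vector_field_local = manifold_map.field_along_local[OF manifold_map_id]

lemma dir_deriv_const:
  shows "dir_deriv A (\<lambda>q. a) p u = 0"
  by (rule dir_derivI) (simp add: o_def)

lemma coord_field_sum:
  assumes "c \<in> A" "p \<in> chart_dom c"
  shows "coord_field A c v p = (\<Sum>b\<in>Basis. (v \<bullet> b) *\<^sub>R coord_field A c b p)"
  by (rule linear_eq_sum_Basis[OF linear_coord_field[OF assms]])

end

locale affine_manifold = manifold B
  for B :: "('m::{t2_space,second_countable_topology}, 'e::euclidean_space) chart set" +
  fixes nabla :: "('m \<Rightarrow> 'e) \<Rightarrow> ('m \<Rightarrow> 'e) \<Rightarrow> 'm \<Rightarrow> 'e"
  assumes connection: "affine_connection B nabla"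
begin

lemma
  assumes "open S" "vector_field_on B S X" "vector_field_on B S Y"
  shows vector_field_nabla: "vector_field_on B S (nabla X Y)"
    and nabla_cong: "\<And>X' Y' p. (\<And>q. q \<in> S \<Longrightarrow> X' q = X q) \<Longrightarrow> (\<And>q. q \<in> S \<Longrightarrow> Y' q = Y q) \<Longrightarrow> p \<in> S \<Longrightarrow>
      nabla X' Y' p = nabla X Y p"
    and nabla_add_left: "\<And>Z p. vector_field_on B S Z \<Longrightarrow> p \<in> S \<Longrightarrow>
      nabla (\<lambda>q. X q + Z q) Y p = nabla X Y p + nabla Z Y p"
    and nabla_add_right: "\<And>Z p. vector_field_on B S Z \<Longrightarrow> p \<in> S \<Longrightarrow>
      nabla X (\<lambda>q. Y q + Z q) p = nabla X Y p + nabla X Z p"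
    and nabla_scaleR_left: "\<And>h p. smooth_fun_on B S h \<Longrightarrow> p \<in> S \<Longrightarrow>
      nabla (\<lambda>q. h q *\<^sub>R X q) Y p = h p *\<^sub>R nabla X Y p"
    and nabla_scaleR_right: "\<And>h p. smooth_fun_on B S h \<Longrightarrow> p \<in> S \<Longrightarrow>
      nabla X (\<lambda>q. h q *\<^sub>R Y q) p = dir_deriv B h p (X p) *\<^sub>R Y p + h p *\<^sub>R nabla X Y p"
proof -
  note conn = connection[unfolded affine_connection_def, rule_format, OF assms]
  show "vector_field_on B S (nabla X Y)"
    using conn by blast
  show "\<And>X' Y' p. (\<And>q. q \<in> S \<Longrightarrow> X' q = X q) \<Longrightarrow> (\<And>q. q \<in> S \<Longrightarrow> Y' q = Y q) \<Longrightarrow> p \<in> S \<Longrightarrow>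
      nabla X' Y' p = nabla X Y p"
    using conn by blast
  show "\<And>Z p. vector_field_on B S Z \<Longrightarrow> p \<in> S \<Longrightarrow>
      nabla (\<lambda>q. X q + Z q) Y p = nabla X Y p + nabla Z Y p"
    using conn by blast
  show "\<And>Z p. vector_field_on B S Z \<Longrightarrow> p \<in> S \<Longrightarrow>
      nabla X (\<lambda>q. Y q + Z q) p = nabla X Y p + nabla X Z p"
    using conn by blast
  show "\<And>h p. smooth_fun_on B S h \<Longrightarrow> p \<in> S \<Longrightarrow>
      nabla (\<lambda>q. h q *\<^sub>R X q) Y p = h p *\<^sub>R nabla X Y p"
    using conn by blast
  show "\<And>h p. smooth_fun_on B S h \<Longrightarrow> p \<in> S \<Longrightarrow>
      nabla X (\<lambda>q. h q *\<^sub>R Y q) p = dir_deriv B h p (X p) *\<^sub>R Y p + h p *\<^sub>R nabla X Y p"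
    using conn by blast
qed

lemma nabla_sum_left:
  assumes S: "open S" "p \<in> S" and Y: "vector_field_on B S Y" and I: "finite I"
    and w: "\<And>i. i \<in> I \<Longrightarrow> smooth_fun_on B S (w i)" and X: "\<And>i. i \<in> I \<Longrightarrow> vector_field_on B S (X i)"
  shows "nabla (\<lambda>q. \<Sum>i\<in>I. w i q *\<^sub>R X i q) Y p = (\<Sum>i\<in>I. w i p *\<^sub>R nabla (X i) Y p)"
  using I w X
proof (induction I rule: finite_induct)
  case empty
  then show ?case using nabla_scaleR_left[OF S(1) Y Y smooth_fun_on_const S(2), of 0] by simp
next
  case (insert i I)
  have 1: "vector_field_on B S (\<lambda>q. w i q *\<^sub>R X i q)"
    using vector_field_sum_scaleR[OF S(1), of "{i}" w X] insert.prems by simp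
  have 2: "vector_field_on B S (\<lambda>q. \<Sum>i\<in>I. w i q *\<^sub>R X i q)"
    using insert.prems by (intro vector_field_sum_scaleR S) auto
  show ?case
    using nabla_add_left[OF S(1) 1 Y 2 S(2)] nabla_scaleR_left[OF S(1) _ Y _ S(2), of "X i" "w i"] insert
    by simp
qed

lemma nabla_sum_right:
  assumes S: "open S" "p \<in> S" and X: "vector_field_on B S X" and I: "finite I"
    and w: "\<And>i. i \<in> I \<Longrightarrow> smooth_fun_on B S (w i)" and Y: "\<And>i. i \<in> I \<Longrightarrow> vector_field_on B S (Y i)"
  shows "nabla X (\<lambda>q. \<Sum>i\<in>I. w i q *\<^sub>R Y i q) p =
    (\<Sum>i\<in>I. dir_deriv B (w i) p (X p) *\<^sub>R Y i p + w i p *\<^sub>R nabla X (Y i) p)"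
  using I w Y
proof (induction I rule: finite_induct)
  case empty
  then show ?case using nabla_scaleR_right[OF S(1) X X smooth_fun_on_const S(2), of 0] by (simp add: dir_deriv_const)
next
  case (insert i I)
  have 1: "vector_field_on B S (\<lambda>q. w i q *\<^sub>R Y i q)"
    using vector_field_sum_scaleR[OF S(1), of "{i}" w Y] insert.prems by simp
  have 2: "vector_field_on B S (\<lambda>q. \<Sum>i\<in>I. w i q *\<^sub>R Y i q)"
    using insert.prems by (intro vector_field_sum_scaleR S) auto
  show ?case
    using nabla_add_right[OF S(1) X 1 2 S(2)] nabla_scaleR_right[OF S(1) X _ _ S(2), of "Y i" "w i"] insert
    by simp
qed

lemma nabla_coord_field_left:
  assumes c: "c \<in> B" "x \<in> chart_dom c" and Y: "vector_field_on B (chart_dom c) Y"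
  shows "nabla (coord_field B c v) Y x = (\<Sum>b\<in>Basis. (v \<bullet> b) *\<^sub>R nabla (coord_field B c b) Y x)"
proof -
  note S = open_chart_dom[OF c(1)] and e = vector_field_coord_field[OF c(1)]
  have "nabla (coord_field B c v) Y x = nabla (\<lambda>q. \<Sum>b\<in>Basis. (v \<bullet> b) *\<^sub>R coord_field B c b q) Y x"
    by (rule nabla_cong[OF S _ Y]) (auto intro: vector_field_sum_scaleR S smooth_fun_on_const e coord_field_sum c)
  also have "\<dots> = (\<Sum>b\<in>Basis. (v \<bullet> b) *\<^sub>R nabla (coord_field B c b) Y x)"
    by (rule nabla_sum_left[OF S c(2) Y finite_Basis smooth_fun_on_const e])
  finally show ?thesis .
qed

lemma nabla_coord_field_right:
  assumes c: "c \<in> B" "x \<in> chart_dom c" and X: "vector_field_on B (chart_dom c) X"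
  shows "nabla X (coord_field B c v) x = (\<Sum>b\<in>Basis. (v \<bullet> b) *\<^sub>R nabla X (coord_field B c b) x)"
proof -
  note S = open_chart_dom[OF c(1)] and e = vector_field_coord_field[OF c(1)]
  have "nabla X (coord_field B c v) x = nabla X (\<lambda>q. \<Sum>b\<in>Basis. (v \<bullet> b) *\<^sub>R coord_field B c b q) x"
    by (rule nabla_cong[OF S X]) (auto intro: vector_field_sum_scaleR S smooth_fun_on_const e coord_field_sum c)
  also have "\<dots> = (\<Sum>b\<in>Basis. dir_deriv B (\<lambda>q. v \<bullet> b) x (X x) *\<^sub>R coord_field B c b x +
      (v \<bullet> b) *\<^sub>R nabla X (coord_field B c b) x)"
    by (rule nabla_sum_right[OF S c(2) X finite_Basis smooth_fun_on_const e])
  finally show ?thesis by (simp add: dir_deriv_const)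
qed

lemma linear_christoffel: "linear (christoffel B nabla x v)"
proof -
  have "christoffel B nabla x v = (\<lambda>w. \<Sum>b\<in>Basis. (w \<bullet> b) *\<^sub>R nabla (coord_field B (chart_at B x) v) (coord_field B (chart_at B x) b) x)"
    unfolding christoffel_def
    by (rule ext) (rule nabla_coord_field_right[OF chart_at vector_field_coord_field[OF chart_at(1)]])
  then show ?thesis
    by (simp only:) (rule linearI; simp add: inner_add_left scaleR_add_left sum.distrib scaleR_sum_right)
qed

lemma nabla_in_chart:
  assumes T: "open T" "x \<in> T" and X: "vector_field_on B T X" and Y: "vector_field_on B T Y"
  shows "nabla X Y x = dir_deriv B (\<lambda>q. components B (chart_at B x) q (Y q)) x (X x)
    + christoffel B nabla x (X x) (Y x)"
proof -
  let ?c = "chart_at B x"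
  let ?T = "T \<inter> chart_dom ?c"
  let ?e = "coord_field B ?c" and ?w = "\<lambda>Y b q. components B ?c q (Y q) \<bullet> b"
  note c = chart_at[of x]
  have S: "open ?T" "x \<in> ?T" using T c open_Int[OF T(1) open_chart_dom[OF c(1)]] by auto
  have XT: "vector_field_on B ?T X" and e: "vector_field_on B ?T (?e v)" for v
    using vector_field_on_subset[OF X] vector_field_on_subset[OF vector_field_coord_field[OF c(1)]] by auto
  have cX: "smooth_fun_on B ?T (\<lambda>q. components B ?c q (X q))" and cY: "smooth_fun_on B ?T (\<lambda>q. components B ?c q (Y q))"
    using smooth_components[OF X c(1)] smooth_components[OF Y c(1)] by auto
  have w: "smooth_fun_on B ?T (?w X b)" "smooth_fun_on B ?T (?w Y b)" for b
    by (intro smooth_fun_on_inner S cX cY)+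
  have ex: "X q = (\<Sum>b\<in>Basis. ?w X b q *\<^sub>R ?e b q)" "Y q = (\<Sum>b\<in>Basis. ?w Y b q *\<^sub>R ?e b q)" if "q \<in> ?T" for q
    using coord_field_expansion[OF c(1)] that by auto
  have Xe: "nabla X (?e b) x = nabla (?e (X x)) (?e b) x" for b
  proof -
    have "nabla X (?e b) x = nabla (\<lambda>q. \<Sum>a\<in>Basis. ?w X a q *\<^sub>R ?e a q) (?e b) x"
      by (rule nabla_cong[OF S(1) _ e _ _ S(2)]) (auto intro!: vector_field_sum_scaleR S w e simp: ex(1)[symmetric])
    also have "\<dots> = (\<Sum>a\<in>Basis. ?w X a x *\<^sub>R nabla (?e a) (?e b) x)"
      by (rule nabla_sum_left[OF S e finite_Basis w(1) e])
    also have "\<dots> = nabla (?e (X x)) (?e b) x"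
      by (simp add: nabla_coord_field_left[OF c vector_field_coord_field[OF c(1)], of "X x"] components_chart_at)
    finally show ?thesis .
  qed
  have "nabla X Y x = nabla X (\<lambda>q. \<Sum>b\<in>Basis. ?w Y b q *\<^sub>R ?e b q) x"
    by (rule nabla_cong[OF S(1) XT _ _ _ S(2)]) (auto intro!: vector_field_sum_scaleR S w e simp: ex(2)[symmetric])
  also have "\<dots> = (\<Sum>b\<in>Basis. dir_deriv B (?w Y b) x (X x) *\<^sub>R ?e b x + ?w Y b x *\<^sub>R nabla X (?e b) x)"
    by (rule nabla_sum_right[OF S XT finite_Basis w(2) e])
  also have "\<dots> = (\<Sum>b\<in>Basis. dir_deriv B (?w Y b) x (X x) *\<^sub>R b) + (\<Sum>b\<in>Basis. (Y x \<bullet> b) *\<^sub>R nabla (?e (X x)) (?e b) x)"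
    by (simp add: sum.distrib coord_field_chart_at components_chart_at Xe)
  also have "(\<Sum>b\<in>Basis. dir_deriv B (?w Y b) x (X x) *\<^sub>R b) = dir_deriv B (\<lambda>q. components B ?c q (Y q)) x (X x)"
    by (simp add: dir_deriv_bounded_linear[OF bounded_linear_inner_left S cY] euclidean_representation)
  also have "(\<Sum>b\<in>Basis. (Y x \<bullet> b) *\<^sub>R nabla (?e (X x)) (?e b) x) = christoffel B nabla x (X x) (Y x)"
    by (simp add: christoffel_def nabla_coord_field_right[OF c vector_field_coord_field[OF c(1)], of "X x" "Y x"])
  finally show ?thesis .
qed

end

locale map_to_affine = manifold_map A B f + target: affine_manifold B nabla
  for A :: "('a::{t2_space,second_countable_topology}, 'd::euclidean_space) chart set"
    and B :: "('m::{t2_space,second_countable_topology}, 'e::euclidean_space) chart set"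
    and f :: "'a \<Rightarrow> 'm"
    and nabla :: "('m \<Rightarrow> 'e) \<Rightarrow> ('m \<Rightarrow> 'e) \<Rightarrow> 'm \<Rightarrow> 'e"
begin

abbreviation covd :: "('a \<Rightarrow> 'd) \<Rightarrow> ('a \<Rightarrow> 'e) \<Rightarrow> 'a \<Rightarrow> 'e" where
  "covd \<equiv> deriv_along A B f nabla"

lemma deriv_along_sum_scaleR_pullback:
  assumes S: "open S" "p \<in> S" "S \<subseteq> f -` T" and T: "open T" and Y: "\<And>i. i \<in> I \<Longrightarrow> vector_field_on B T (Y i)"
    and w: "\<And>i. i \<in> I \<Longrightarrow> smooth_fun_on A S (w i)"
    and W: "\<And>q. q \<in> S \<Longrightarrow> W q = (\<Sum>i\<in>I. w i q *\<^sub>R Y i (f q))"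
    and X: "vector_field_on B T X" "X (f p) = df p (U p)"
  shows "covd U W p = (\<Sum>i\<in>I. dir_deriv A (w i) p (U p) *\<^sub>R Y i (f p) + w i p *\<^sub>R nabla X (Y i) (f p))"
proof -
  let ?c = "chart_at B (f p)"
  let ?S = "S \<inter> f -` chart_dom ?c" and ?T = "T \<inter> chart_dom ?c"
  let ?y = "\<lambda>i x. components B ?c x (Y i x)"
  note c = target.chart_at[of "f p"]
  have oS: "open ?S" "p \<in> ?S" using S c open_Int_vimage_chart by auto
  have oT: "open ?T" "f p \<in> ?T" "f p \<in> T" using T S c open_Int[OF T target.open_chart_dom[OF c(1)]] by auto
  have y: "smooth_fun_on B ?T (?y i)" if "i \<in> I" for i
    using target.smooth_components[OF Y[OF that] c(1)] .
  have yf: "smooth_fun_on A ?S (\<lambda>q. ?y i (f q))" if "i \<in> I" for i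
    by (rule source.smooth_fun_on_subset[OF smooth_fun_on_pullback[OF oT(1) y[OF that]]]) (use S(3) in auto)
  have "dir_deriv A (\<lambda>q. components B ?c (f q) (W q)) p (U p) =
     dir_deriv A (\<lambda>q. \<Sum>i\<in>I. w i q *\<^sub>R ?y i (f q)) p (U p)"
    by (subst source.dir_deriv_cong[OF oS])
       (auto simp: W linear_sum[OF target.linear_components[OF c(1)]] linear_cmul[OF target.linear_components[OF c(1)]])
  also have "\<dots> = (\<Sum>i\<in>I. dir_deriv A (w i) p (U p) *\<^sub>R ?y i (f p) + w i p *\<^sub>R dir_deriv A (\<lambda>q. ?y i (f q)) p (U p))"
    by (rule source.dir_deriv_sum_scaleR[OF oS source.smooth_fun_on_subset[OF w] yf]) auto
  also have "\<dots> = (\<Sum>i\<in>I. dir_deriv A (w i) p (U p) *\<^sub>R Y i (f p) + w i p *\<^sub>R dir_deriv B (?y i) (f p) (X (f p)))"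
    by (intro sum.cong refl) (simp add: dir_deriv_pullback[OF oT(1,2) y] X(2) target.components_chart_at)
  finally have 1: "dir_deriv A (\<lambda>q. components B ?c (f q) (W q)) p (U p) = \<dots>" .
  have "christoffel B nabla (f p) (X (f p)) (W p) = (\<Sum>i\<in>I. w i p *\<^sub>R christoffel B nabla (f p) (X (f p)) (Y i (f p)))"
    using W[OF S(2)] by (simp add: linear_sum[OF target.linear_christoffel] linear_cmul[OF target.linear_christoffel])
  moreover have "nabla X (Y i) (f p) = dir_deriv B (?y i) (f p) (X (f p)) + christoffel B nabla (f p) (X (f p)) (Y i (f p))"
    if "i \<in> I" for i
    by (rule target.nabla_in_chart[OF T oT(3) X(1) Y[OF that]])
  ultimately show ?thesis
    by (simp add: deriv_along_def 1 X(2)[symmetric] sum.distrib scaleR_add_right)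
qed

lemma deriv_along_add:
  assumes "open S" "p \<in> S" "field_along S W" "field_along S W'"
  shows "covd U (\<lambda>q. W q + W' q) p = covd U W p + covd U W' p"
proof -
  let ?c = "chart_at B (f p)"
  let ?S = "S \<inter> f -` chart_dom ?c"
  note c = target.chart_at[of "f p"]
  have oS: "open ?S" "p \<in> ?S" using assms c open_Int_vimage_chart by auto
  have "dir_deriv A (\<lambda>q. components B ?c (f q) (W q + W' q)) p (U p) =
    dir_deriv A (\<lambda>q. components B ?c (f q) (W q) + components B ?c (f q) (W' q)) p (U p)"
    by (subst source.dir_deriv_cong[OF oS]) (auto simp: linear_add[OF target.linear_components[OF c(1)]])
  then show ?thesis
    using source.dir_deriv_add[OF oS field_along_components[OF assms(3) c(1)] field_along_components[OF assms(4) c(1)]]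
    by (simp add: deriv_along_def linear_add[OF target.linear_christoffel])
qed

lemma deriv_along_scaleR:
  assumes "open S" "p \<in> S" "field_along S W"
  shows "covd U (\<lambda>q. a *\<^sub>R W q) p = a *\<^sub>R covd U W p"
proof -
  let ?c = "chart_at B (f p)"
  let ?S = "S \<inter> f -` chart_dom ?c"
  note c = target.chart_at[of "f p"]
  have oS: "open ?S" "p \<in> ?S" using assms c open_Int_vimage_chart by auto
  have "dir_deriv A (\<lambda>q. components B ?c (f q) (a *\<^sub>R W q)) p (U p) =
    dir_deriv A (\<lambda>q. a *\<^sub>R components B ?c (f q) (W q)) p (U p)"
    by (subst source.dir_deriv_cong[OF oS]) (auto simp: linear_cmul[OF target.linear_components[OF c(1)]])
  then show ?thesis
    using source.dir_deriv_bounded_linear[OF bounded_linear_scaleR_right oS field_along_components[OF assms(3) c(1)]]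
    by (simp add: deriv_along_def linear_cmul[OF target.linear_christoffel] scaleR_add_right)
qed

lemma deriv_along_parallel:
  assumes lin: "\<And>x. linear (\<phi> x)"
    and vf: "\<And>S X. open S \<Longrightarrow> vector_field_on B S X \<Longrightarrow> vector_field_on B S (\<lambda>x. \<phi> x (X x))"
    and par: "\<And>S X Y x. open S \<Longrightarrow> vector_field_on B S X \<Longrightarrow> vector_field_on B S Y \<Longrightarrow> x \<in> S \<Longrightarrow>
        nabla X (\<lambda>q. \<phi> q (Y q)) x = \<phi> x (nabla X Y x)"
    and S: "open S" "p \<in> S" and W: "field_along S W"
  shows "covd U (\<lambda>q. \<phi> (f q) (W q)) p = \<phi> (f p) (covd U W p)"
proof -
  let ?c = "chart_at B (f p)"
  let ?S = "S \<inter> f -` chart_dom ?c"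
  let ?w = "\<lambda>b q. components B ?c (f q) (W q) \<bullet> b" and ?e = "coord_field B ?c"
  let ?X = "coord_field B ?c (df p (U p))"
  note c = target.chart_at[of "f p"]
  have oS: "open ?S" "p \<in> ?S" "?S \<subseteq> f -` chart_dom ?c" using S c open_Int_vimage_chart by auto
  note T = target.open_chart_dom[OF c(1)]
  have e: "vector_field_on B (chart_dom ?c) (?e v)" for v by (rule target.vector_field_coord_field[OF c(1)])
  have w: "smooth_fun_on A ?S (?w b)" for b by (rule field_along_expansion(2)[OF c(1) W S(1)])
  have X: "?X (f p) = df p (U p)" by (rule target.coord_field_chart_at)
  have Wq: "W q = (\<Sum>b\<in>Basis. ?w b q *\<^sub>R ?e b (f q))" if "q \<in> ?S" for q
    using field_along_expansion(1)[OF c(1) W] that by simp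
  have 1: "covd U W p = (\<Sum>b\<in>Basis. dir_deriv A (?w b) p (U p) *\<^sub>R ?e b (f p) + ?w b p *\<^sub>R nabla ?X (?e b) (f p))"
    by (rule deriv_along_sum_scaleR_pullback[where U = U and W = W and w = ?w and Y = ?e and X = ?X,
        OF oS T e w Wq e X])
  have "covd U (\<lambda>q. \<phi> (f q) (W q)) p = (\<Sum>b\<in>Basis. dir_deriv A (?w b) p (U p) *\<^sub>R \<phi> (f p) (?e b (f p))
      + ?w b p *\<^sub>R nabla ?X (\<lambda>x. \<phi> x (?e b x)) (f p))"
  proof (rule deriv_along_sum_scaleR_pullback[where U = U and w = ?w and Y = "\<lambda>b x. \<phi> x (?e b x)" and X = ?X,
        OF oS T vf[OF T e] w _ e X])
    show "\<phi> (f q) (W q) = (\<Sum>b\<in>Basis. ?w b q *\<^sub>R \<phi> (f q) (?e b (f q)))" if "q \<in> ?S" for q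
      by (subst Wq[OF that]) (simp add: linear_sum[OF lin] linear_cmul[OF lin])
  qed
  then show ?thesis
    by (simp add: 1 linear_sum[OF lin] linear_add[OF lin] linear_cmul[OF lin] par[OF T e e c(2)])
qed

lemma field_along_deriv_along:
  assumes S: "open S" and U: "vector_field_on A S U" and W: "field_along S W"
  shows "field_along S (covd U W)"
proof (rule field_along_local[OF S])
  fix p assume p: "p \<in> S"
  let ?c = "chart_at B (f p)"
  let ?S = "S \<inter> f -` chart_dom ?c"
  let ?w = "\<lambda>b q. components B ?c (f q) (W q) \<bullet> b" and ?e = "coord_field B ?c"
  let ?u = "\<lambda>a q. components B ?c (f q) (df q (U q)) \<bullet> a"
  note c = target.chart_at[of "f p"]
  have oS: "open ?S" "p \<in> ?S" using S p c open_Int_vimage_chart by auto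
  note T = target.open_chart_dom[OF c(1)]
  have e: "vector_field_on B (chart_dom ?c) (?e v)" for v by (rule target.vector_field_coord_field[OF c(1)])
  have w: "smooth_fun_on A ?S (?w b)" for b by (rule field_along_expansion(2)[OF c(1) W S(1)])
  have u: "smooth_fun_on A ?S (?u b)" for b
    by (rule field_along_expansion(2)[OF c(1) field_along_pushforward[OF S U] S(1)])
  have Wq: "W q = (\<Sum>b\<in>Basis. ?w b q *\<^sub>R ?e b (f q))" if "q \<in> ?S" for q
    using field_along_expansion(1)[OF c(1) W] that by simp
  have pull: "field_along ?S (\<lambda>q. Y (f q))" if "vector_field_on B (chart_dom ?c) Y" for Y
    using field_along_subset[OF field_along_pullback[OF T that]] by simp
  have dw: "smooth_fun_on A ?S (\<lambda>q. dir_deriv A (?w b) q (U q))" for b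
    using source.vector_field_on_subset[OF U] by (intro source.smooth_dir_deriv oS w) auto
  have "field_along ?S (\<lambda>q. (\<Sum>b\<in>Basis. dir_deriv A (?w b) q (U q) *\<^sub>R ?e b (f q)) +
      (\<Sum>b\<in>Basis. ?w b q *\<^sub>R (\<Sum>a\<in>Basis. ?u a q *\<^sub>R nabla (?e a) (?e b) (f q))))"
    by (intro field_along_add field_along_sum_scaleR oS dw w u pull e target.vector_field_nabla T)
  moreover have "(\<Sum>b\<in>Basis. dir_deriv A (?w b) q (U q) *\<^sub>R ?e b (f q)) +
      (\<Sum>b\<in>Basis. ?w b q *\<^sub>R (\<Sum>a\<in>Basis. ?u a q *\<^sub>R nabla (?e a) (?e b) (f q))) = covd U W q" if q: "q \<in> ?S" for q
  proof -
    let ?X = "?e (components B ?c (f q) (df q (U q)))"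
    have "?X (f q) = df q (U q)" using q by (simp add: target.coord_field_components[OF c(1)])
    from deriv_along_sum_scaleR_pullback[where U = U and W = W and w = ?w and Y = ?e and X = ?X,
        OF oS(1) q _ T e w Wq e this]
    have "covd U W q = (\<Sum>b\<in>Basis. dir_deriv A (?w b) q (U q) *\<^sub>R ?e b (f q) + ?w b q *\<^sub>R nabla ?X (?e b) (f q))"
      by simp
    then show ?thesis
      using q by (simp add: sum.distrib target.nabla_coord_field_left[OF c(1) _ e, of _ "components B ?c (f q) (df q (U q))"])
  qed
  ultimately have "field_along ?S (covd U W)"
    by (rule field_along_cong[OF oS(1), rotated])
  then show "\<exists>N. open N \<and> p \<in> N \<and> field_along N (covd U W)" using oS by blast
qed

end

section \<open>Smoothness of orthogonal projections\<close>

lemma (in manifold) smooth_gram_solution: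
  fixes G :: "'i \<Rightarrow> 'i \<Rightarrow> 'a \<Rightarrow> real"
  assumes I: "finite I" and S: "open S"
    and G: "\<And>i j. i \<in> I \<Longrightarrow> j \<in> I \<Longrightarrow> smooth_fun_on A S (G i j)"
    and sym: "\<And>i j p. p \<in> S \<Longrightarrow> i \<in> I \<Longrightarrow> j \<in> I \<Longrightarrow> G i j p = G j i p"
    and pos: "\<And>c p. p \<in> S \<Longrightarrow> \<exists>i\<in>I. c i \<noteq> 0 \<Longrightarrow> 0 < (\<Sum>i\<in>I. \<Sum>j\<in>I. c i * c j * G i j p)"
    and b: "\<And>i. i \<in> I \<Longrightarrow> smooth_fun_on A S (b i)"
    and eq: "\<And>i p. p \<in> S \<Longrightarrow> i \<in> I \<Longrightarrow> (\<Sum>j\<in>I. G i j p * a j p) = b i p"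
    and i: "i \<in> I"
  shows "smooth_fun_on A S (a i)"
  using I G sym pos b eq i
proof (induction I arbitrary: G b i rule: finite_induct)
  case empty
  then show ?case by simp
next
  \<comment> \<open>Gaussian elimination: the Schur complement \<open>G'\<close> of the pivot \<open>G k k > 0\<close> is again positive definite.\<close>
  case (insert k I)
  let ?s = "\<lambda>c p. \<Sum>j\<in>I. c j * G k j p"
  let ?R = "\<lambda>c p. \<Sum>i\<in>I. \<Sum>j\<in>I. c i * c j * G i j p"
  define G' where "G' i j p = G i j p - G i k p * G k j p * inverse (G k k p)" for i j p
  define b' where "b' i p = b i p - G i k p * b k p * inverse (G k k p)" for i p
  have ik: "G i k p = G k i p" if "p \<in> S" "i \<in> I" for i p
    using insert.prems(2) that by blast
  have expand: "0 < t * t * G k k p + 2 * t * ?s c p + ?R c p" if "p \<in> S" "t \<noteq> 0 \<or> (\<exists>i\<in>I. c i \<noteq> 0)" for t c p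
  proof -
    let ?c = "c(k := t)"
    have "0 < (\<Sum>i\<in>insert k I. \<Sum>j\<in>insert k I. ?c i * ?c j * G i j p)"
      using that insert.hyps by (intro insert.prems(3)) auto
    also have "\<dots> = t * t * G k k p + (\<Sum>j\<in>I. t * c j * G k j p) + (\<Sum>i\<in>I. c i * t * G i k p + (\<Sum>j\<in>I. c i * c j * G i j p))"
    proof -
      have c: "?c i = c i" if "i \<in> I" for i using that insert.hyps by auto
      show ?thesis
        by (simp only: sum.insert[OF insert.hyps] fun_upd_same c cong: sum.cong)
    qed
    also have "(\<Sum>i\<in>I. c i * t * G i k p + (\<Sum>j\<in>I. c i * c j * G i j p)) = t * ?s c p + ?R c p"
      by (simp add: ik[OF that(1)] sum.distrib sum_distrib_left ac_simps cong: sum.cong)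
    also have "(\<Sum>j\<in>I. t * c j * G k j p) = t * ?s c p" by (simp add: sum_distrib_left ac_simps)
    finally show ?thesis by simp
  qed
  have kk: "0 < G k k p" if "p \<in> S" for p
    using expand[OF that, of 1 "\<lambda>_. 0"] by simp
  have inv: "smooth_fun_on A S (\<lambda>p. inverse (G k k p))"
    using insert.prems(1) kk by (intro smooth_fun_on_inverse S) force+
  have IH: "smooth_fun_on A S (a i)" if "i \<in> I" for i
  proof (rule insert.IH[of G' b'])
    show "smooth_fun_on A S (G' i j)" if "i \<in> I" "j \<in> I" for i j
      unfolding G'_def using that insert.prems(1)
      by (intro smooth_fun_on_diff smooth_fun_on_mult S inv) auto
    show "smooth_fun_on A S (b' i)" if "i \<in> I" for i
      unfolding b'_def using that insert.prems(1,4)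
      by (intro smooth_fun_on_diff smooth_fun_on_mult S inv) auto
    show "G' i j p = G' j i p" if "p \<in> S" "i \<in> I" "j \<in> I" for i j p
      using insert.prems(2)[of p i j] ik[of p i] ik[of p j] that by (simp add: G'_def)
    show "0 < (\<Sum>i\<in>I. \<Sum>j\<in>I. c i * c j * G' i j p)" if p: "p \<in> S" and c: "\<exists>i\<in>I. c i \<noteq> 0" for c p
    proof -
      define t where "t = - ?s c p / G k k p"
      have "(\<Sum>i\<in>I. \<Sum>j\<in>I. c i * c j * G' i j p) = ?R c p - (\<Sum>i\<in>I. \<Sum>j\<in>I. (c i * G k i p) * (c j * G k j p)) * inverse (G k k p)"
        by (simp add: ik[OF p] G'_def right_diff_distrib sum_subtractf sum_distrib_left sum_distrib_right ac_simps cong: sum.cong)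
      also have "(\<Sum>i\<in>I. \<Sum>j\<in>I. (c i * G k i p) * (c j * G k j p)) = ?s c p * ?s c p"
        by (simp add: sum_product)
      also have "?R c p - ?s c p * ?s c p * inverse (G k k p) = t * t * G k k p + 2 * t * ?s c p + ?R c p"
        using kk[OF p] by (simp add: t_def field_simps)
      finally show ?thesis using expand[OF p, of t c] c by simp
    qed
    show "(\<Sum>j\<in>I. G' i j p * a j p) = b' i p" if p: "p \<in> S" and i: "i \<in> I" for i p
    proof -
      have "(\<Sum>j\<in>I. G k j p * a j p) = b k p - G k k p * a k p"
        using insert.prems(5)[OF p, of k] insert.hyps by simp
      moreover have "(\<Sum>j\<in>I. G i j p * a j p) = b i p - G i k p * a k p"
        using insert.prems(5)[OF p, of i] insert.hyps i by simp
      moreover have "(\<Sum>j\<in>I. G' i j p * a j p) =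
          (\<Sum>j\<in>I. G i j p * a j p) - G i k p * inverse (G k k p) * (\<Sum>j\<in>I. G k j p * a j p)"
        by (simp add: G'_def left_diff_distrib right_diff_distrib sum_subtractf sum_distrib_left ac_simps)
      ultimately have "(\<Sum>j\<in>I. G' i j p * a j p) =
          b i p - G i k p * a k p - G i k p * inverse (G k k p) * (b k p - G k k p * a k p)"
        by simp
      then show ?thesis using kk[OF p] by (simp add: b'_def field_simps)
    qed
  qed fact
  have "smooth_fun_on A S (\<lambda>p. (b k p - (\<Sum>j\<in>I. G k j p * a j p)) * inverse (G k k p))"
    using insert.prems(1,4) IH
    by (intro smooth_fun_on_mult smooth_fun_on_diff smooth_fun_on_sum S inv) auto
  then have "smooth_fun_on A S (a k)"
  proof (rule smooth_fun_on_cong[OF S, rotated])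
    show "(b k p - (\<Sum>j\<in>I. G k j p * a j p)) * inverse (G k k p) = a k p" if "p \<in> S" for p
      using insert.prems(5)[OF that, of k] insert.hyps kk[OF that] by (simp add: field_simps)
  qed
  with IH insert.prems(6) show ?case by auto
qed

lemma
  assumes "riemannian_metric A g"
  shows riemannian_linear_left: "linear (\<lambda>v. g p v w)"
    and riemannian_linear_right: "linear (g p v)"
    and riemannian_sym: "g p v w = g p w v"
    and riemannian_pos: "v \<noteq> 0 \<Longrightarrow> 0 < g p v v"
    and riemannian_zero_iff: "g p v v = 0 \<longleftrightarrow> v = 0"
  using assms by (auto simp: riemannian_metric_def bilinear_def linear_0 less_le)

lemma smooth_riemannian_metric:
  "riemannian_metric A g \<Longrightarrow> open S \<Longrightarrow> vector_field_on A S X \<Longrightarrow> vector_field_on A S Y \<Longrightarrow>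
    smooth_fun_on A S (\<lambda>p. g p (X p) (Y p))"
  by (simp add: riemannian_metric_def)

lemma (in manifold) vector_field_from_frame:
  assumes g: "riemannian_metric A g" and S: "open S" and I: "finite I"
    and E: "\<And>i. i \<in> I \<Longrightarrow> vector_field_on A S (E i)"
    and ind: "\<And>p c. p \<in> S \<Longrightarrow> (\<Sum>i\<in>I. c i *\<^sub>R E i p) = 0 \<Longrightarrow> \<forall>i\<in>I. c i = 0"
    and Y: "\<And>p. p \<in> S \<Longrightarrow> \<exists>c. Y p = (\<Sum>i\<in>I. c i *\<^sub>R E i p)"
    and b: "\<And>i. i \<in> I \<Longrightarrow> smooth_fun_on A S (\<lambda>p. g p (E i p) (Y p))"
  shows "vector_field_on A S Y"
proof -
  note lin = riemannian_linear_left[OF g] riemannian_linear_right[OF g]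
  obtain a where a: "\<And>p. p \<in> S \<Longrightarrow> Y p = (\<Sum>i\<in>I. a i p *\<^sub>R E i p)"
  proof -
    have "\<forall>p\<in>S. \<exists>c. Y p = (\<Sum>i\<in>I. c i *\<^sub>R E i p)" using Y by blast
    then obtain c where "\<forall>p\<in>S. Y p = (\<Sum>i\<in>I. c p i *\<^sub>R E i p)" by (rule bchoice[THEN exE])
    then show ?thesis by (intro that[of "\<lambda>i p. c p i"]) auto
  qed
  have "smooth_fun_on A S (a i)" if "i \<in> I" for i
  proof (rule smooth_gram_solution[where G = "\<lambda>i j p. g p (E i p) (E j p)", OF I S _ _ _ b _ that])
    show "smooth_fun_on A S (\<lambda>p. g p (E i p) (E j p))" if "i \<in> I" "j \<in> I" for i j
      by (rule smooth_riemannian_metric[OF g S E[OF that(1)] E[OF that(2)]])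
    show "g p (E i p) (E j p) = g p (E j p) (E i p)" for i j p by (rule riemannian_sym[OF g])
    show "0 < (\<Sum>i\<in>I. \<Sum>j\<in>I. c i * c j * g p (E i p) (E j p))" if "p \<in> S" "\<exists>i\<in>I. c i \<noteq> 0" for c p
    proof -
      have "0 < g p (\<Sum>i\<in>I. c i *\<^sub>R E i p) (\<Sum>i\<in>I. c i *\<^sub>R E i p)"
        using ind[OF that(1)] that(2) by (intro riemannian_pos[OF g]) auto
      also have "\<dots> = (\<Sum>i\<in>I. \<Sum>j\<in>I. c i * c j * g p (E i p) (E j p))"
        by (subst sum.swap) (simp add: linear_sum[OF lin(1)] linear_cmul[OF lin(1)] linear_sum[OF lin(2)]
          linear_cmul[OF lin(2)] sum_distrib_left ac_simps)
      finally show ?thesis .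
    qed
    show "(\<Sum>j\<in>I. g p (E i p) (E j p) * a j p) = g p (E i p) (Y p)" if "p \<in> S" for i p
      using a[OF that] by (simp add: linear_sum[OF lin(2)] linear_cmul[OF lin(2)] ac_simps)
  qed
  then have "vector_field_on A S (\<lambda>p. \<Sum>i\<in>I. a i p *\<^sub>R E i p)"
    by (intro vector_field_sum_scaleR S E)
  then show ?thesis by (rule vector_field_cong[OF S, rotated]) (simp add: a)
qed

lemma independent_family_of_dim:
  fixes E :: "nat \<Rightarrow> 'a::euclidean_space"
  assumes "dim (span (E ` {..<k})) = k" "(\<Sum>i<k. c i *\<^sub>R E i) = 0" "i < k"
  shows "c i = 0"
proof -
  have k: "k \<le> card (E ` {..<k})" using dim_le_card'[of "E ` {..<k}"] assms(1) by simp
  have card: "card (E ` {..<k}) = k" using k card_image_le[of "{..<k}" E] by simp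
  then have inj: "inj_on E {..<k}" by (intro eq_card_imp_inj_on) auto
  have "independent (E ` {..<k})"
    using assms(1) card by (intro card_le_dim_spanning[of _ "span (E ` {..<k})"]) (auto simp: span_base)
  moreover have "(\<Sum>v\<in>E ` {..<k}. c (the_inv_into {..<k} E v) *\<^sub>R v) = 0"
    using assms(2) by (simp add: sum.reindex[OF inj] the_inv_into_f_f[OF inj])
  ultimately have "c (the_inv_into {..<k} E (E i)) = 0"
    using assms(3) independentD[of "E ` {..<k}" "E ` {..<k}" "\<lambda>v. c (the_inv_into {..<k} E v)" "E i"] by auto
  then show ?thesis using the_inv_into_f_f[OF inj] assms(3) by simp
qed

lemma (in manifold) vector_field_orthogonal_projection:
  assumes g: "riemannian_metric A g" and D: "distribution A k D" and X: "vector_field_on A UNIV X"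
    and Y: "\<And>p. Y p \<in> D p" "\<And>p z. z \<in> D p \<Longrightarrow> g p (X p - Y p) z = 0"
  shows "vector_field_on A UNIV Y"
proof (rule vector_field_local[OF open_UNIV])
  fix p :: 'a
  obtain S E where S: "open S" "p \<in> S" and E: "\<And>i. i < k \<Longrightarrow> vector_field_on A S (E i)"
    and DE: "\<And>q. q \<in> S \<Longrightarrow> D q = span ((\<lambda>i. E i q) ` {..<k})"
  proof -
    have "\<exists>S E. open S \<and> p \<in> S \<and> (\<forall>i<k. vector_field_on A S (E i)) \<and> (\<forall>q\<in>S. D q = span ((\<lambda>i. E i q) ` {..<k}))"
      using D by (simp add: distribution_def)
    then obtain S E where "open S" "p \<in> S" "\<forall>i<k. vector_field_on A S (E i)"
      "\<forall>q\<in>S. D q = span ((\<lambda>i. E i q) ` {..<k})" by (elim exE conjE)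
    then show thesis by (intro that[of S E]) simp_all
  qed
  have dim: "dim (D q) = k" for q using D by (simp add: distribution_def)
  have "vector_field_on A S Y"
  proof (rule vector_field_from_frame[OF g S(1), of "{..<k}" E])
    show "\<forall>i\<in>{..<k}. c i = 0" if "q \<in> S" "(\<Sum>i<k. c i *\<^sub>R E i q) = 0" for q c
      using independent_family_of_dim[of "\<lambda>i. E i q" k c] dim[of q] DE[OF that(1)] that(2) by auto
    show "\<exists>c. Y q = (\<Sum>i<k. c i *\<^sub>R E i q)" if "q \<in> S" for q
    proof -
      have "Y q \<in> span ((\<lambda>i. E i q) ` {..<k})" using Y(1) DE[OF that] by auto
      then show ?thesis
      proof (induction rule: span_induct_alt)
        case base
        show ?case by (rule exI[of _ "\<lambda>_. 0"]) simp
      next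
        case (step a x y)
        then obtain i c where "i < k" "x = E i q" "y = (\<Sum>i<k. c i *\<^sub>R E i q)" by auto
        then have "a *\<^sub>R x + y = (\<Sum>j<k. (c j + (if j = i then a else 0)) *\<^sub>R E j q)"
          by (simp add: scaleR_add_left sum.distrib if_distrib[of "\<lambda>t. t *\<^sub>R _"] sum.delta cong: if_cong)
        then show ?case by (intro exI[of _ "\<lambda>j. c j + (if j = i then a else 0)"])
      qed
    qed
    show "smooth_fun_on A S (\<lambda>q. g q (E i q) (Y q))" if "i \<in> {..<k}" for i
    proof (rule smooth_fun_on_cong[OF S(1) _ smooth_riemannian_metric[OF g S(1) E vector_field_on_subset[OF X]]])
      show "g q (E i q) (X q) = g q (E i q) (Y q)" if "q \<in> S" for q
        using Y(2)[of "E i q" q] \<open>i \<in> {..<k}\<close> DE[OF that] riemannian_sym[OF g, of q "E i q"]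
          linear_diff[OF riemannian_linear_left[OF g]] by (simp add: span_base)
    qed (use that in auto)
  qed (use E in auto)
  with S show "\<exists>N. open N \<and> p \<in> N \<and> vector_field_on A N Y" by blast
qed

locale immersion = manifold_map A B f
  for A :: "('a::{t2_space,second_countable_topology}, 'd::euclidean_space) chart set"
    and B :: "('m::{t2_space,second_countable_topology}, 'e::euclidean_space) chart set"
    and f :: "'a \<Rightarrow> 'm" +
  fixes gM :: "'a \<Rightarrow> 'd \<Rightarrow> 'd \<Rightarrow> real" and g :: "'m \<Rightarrow> 'e \<Rightarrow> 'e \<Rightarrow> real"
  assumes gM: "riemannian_metric A gM" and g: "riemannian_metric B g"
    and isometric: "\<And>p u v. gM p u v = g (f p) (tangent_map A B f p u) (tangent_map A B f p v)"
begin

abbreviation tan_part :: "'a \<Rightarrow> 'e \<Rightarrow> 'd" where "tan_part \<equiv> tangential_part A B g f"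
abbreviation nor_part :: "'a \<Rightarrow> 'e \<Rightarrow> 'e" where "nor_part \<equiv> normal_part A B g f"

lemmas g_simps = linear_add[OF riemannian_linear_left[OF g]] linear_diff[OF riemannian_linear_left[OF g]]
  linear_cmul[OF riemannian_linear_left[OF g]] linear_neg[OF riemannian_linear_left[OF g]]
  linear_add[OF riemannian_linear_right[OF g]] linear_diff[OF riemannian_linear_right[OF g]]
  linear_cmul[OF riemannian_linear_right[OF g]] linear_neg[OF riemannian_linear_right[OF g]]
  linear_0[OF riemannian_linear_left[OF g]] linear_0[OF riemannian_linear_right[OF g]]

lemmas gM_simps = linear_add[OF riemannian_linear_left[OF gM]] linear_diff[OF riemannian_linear_left[OF gM]]
  linear_cmul[OF riemannian_linear_left[OF gM]] linear_neg[OF riemannian_linear_left[OF gM]]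
  linear_add[OF riemannian_linear_right[OF gM]] linear_diff[OF riemannian_linear_right[OF gM]]
  linear_cmul[OF riemannian_linear_right[OF gM]] linear_neg[OF riemannian_linear_right[OF gM]]
  linear_0[OF riemannian_linear_left[OF gM]] linear_0[OF riemannian_linear_right[OF gM]]

lemmas df_simps = linear_add[OF linear_df] linear_diff[OF linear_df] linear_cmul[OF linear_df]
  linear_neg[OF linear_df] linear_0[OF linear_df]

lemma tangential_part_unique:
  assumes "\<And>w. g (f p) (v - df p u) (df p w) = 0"
  shows "tan_part p v = u"
  unfolding tangential_part_def
proof (rule the_equality)
  fix u' assume u': "\<forall>w. g (f p) (v - df p u') (df p w) = 0"
  have "gM p (u - u') (u - u') = 0"
    using u'[rule_format, of "u - u'"] assms[of "u - u'"]
    by (simp add: isometric df_simps g_simps)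
  then show "u' = u" by (simp add: riemannian_zero_iff[OF gM])
qed (use assms in blast)

lemma tangential_part_exists: "\<exists>u. \<forall>w. g (f p) (v - df p u) (df p w) = 0"
proof -
  define L where "L u = (\<Sum>b\<in>Basis. gM p u b *\<^sub>R b)" for u
  have L: "linear L"
    unfolding L_def by (rule linearI) (simp_all add: gM_simps scaleR_add_left sum.distrib scaleR_sum_right)
  have Lb: "L u \<bullet> b = gM p u b" if "b \<in> Basis" for u b
    using that by (simp add: L_def inner_sum_left_Basis)
  have "inj L"
  proof (rule linear_injective_0[OF L, THEN iffD2], intro allI impI)
    fix u assume "L u = 0"
    then have "gM p u b = 0" if "b \<in> Basis" for b using Lb[OF that, of u] by simp
    then have "gM p u u = 0"
      using linear_eq_sum_Basis[OF riemannian_linear_right[OF gM], of p u u] by simp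
    then show "u = 0" by (simp add: riemannian_zero_iff[OF gM])
  qed
  then have "surj L" using linear_injective_imp_surjective[OF L] by simp
  then obtain u where u: "L u = (\<Sum>b\<in>Basis. g (f p) v (df p b) *\<^sub>R b)" by (metis surjD)
  have "gM p u b = g (f p) v (df p b)" if "b \<in> Basis" for b
    using Lb[OF that, of u] that by (simp add: u inner_sum_left_Basis)
  then have b: "g (f p) (v - df p u) (df p b) = 0" if "b \<in> Basis" for b
    using that by (simp add: g_simps isometric)
  have "g (f p) (v - df p u) (df p w) = 0" for w
  proof -
    have "linear (\<lambda>w. g (f p) (v - df p u) (df p w))"
      using linear_compose[OF linear_df riemannian_linear_right[OF g]] by (simp add: o_def)
    from linear_eq_sum_Basis[OF this, of w] show ?thesis using b by simp
  qed
  then show ?thesis by blast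
qed

lemma tangential_part_orthogonal: "g (f p) (v - df p (tan_part p v)) (df p w) = 0"
  using tangential_part_exists tangential_part_unique by metis

lemma gM_tangential_part: "gM p (tan_part p v) w = g (f p) v (df p w)"
  using tangential_part_orthogonal[of p v w] by (simp add: g_simps isometric)

lemma normal_part_orthogonal: "g (f p) (nor_part p v) (df p w) = 0"
  using tangential_part_orthogonal by (simp add: normal_part_def)

lemma tangential_part_df: "tan_part p (df p u) = u"
  by (rule tangential_part_unique) (simp add: g_simps)

lemma linear_tangential_part: "linear (tan_part p)"
proof (rule linearI)
  show "tan_part p (v + w) = tan_part p v + tan_part p w" for v w
    using tangential_part_orthogonal[of p v] tangential_part_orthogonal[of p w]
    by (intro tangential_part_unique) (simp add: df_simps g_simps)
  show "tan_part p (a *\<^sub>R v) = a *\<^sub>R tan_part p v" for a v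
    using tangential_part_orthogonal[of p v]
    by (intro tangential_part_unique) (simp add: df_simps g_simps)
qed

lemma linear_normal_part: "linear (nor_part p)"
  unfolding normal_part_def using linear_compose_sub[OF linear_id linear_compose[OF linear_tangential_part linear_df]]
  by (simp add: o_def)

lemma normal_part_df: "nor_part p (df p u) = 0"
  by (simp add: normal_part_def tangential_part_df)

lemma vector_field_tangential_part:
  assumes S: "open S" and W: "field_along S W"
  shows "vector_field_on A S (\<lambda>p. tan_part p (W p))"
proof (rule source.vector_field_local[OF S])
  fix p assume p: "p \<in> S"
  let ?c = "chart_at A p"
  let ?S = "S \<inter> chart_dom ?c"
  note c = source.chart_at[of p]
  have oS: "open ?S" "p \<in> ?S" using open_Int[OF S source.open_chart_dom[OF c(1)]] p c by auto
  have e: "vector_field_on A ?S (coord_field A ?c v)" for v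
    by (rule source.vector_field_on_subset[OF source.vector_field_coord_field[OF c(1)]]) simp
  have "vector_field_on A ?S (\<lambda>p. tan_part p (W p))"
  proof (rule source.vector_field_from_frame[OF gM oS(1) finite_Basis e])
    show "\<forall>b\<in>Basis. k b = 0" if q: "q \<in> ?S" and k: "(\<Sum>b\<in>Basis. k b *\<^sub>R coord_field A ?c b q) = 0" for q k
    proof -
      have q': "q \<in> chart_dom ?c" using q by simp
      note lin = source.linear_coord_field[OF c(1) q'] source.linear_components[OF c(1) q']
      have "components A ?c q (coord_field A ?c (\<Sum>b\<in>Basis. k b *\<^sub>R b) q) = 0"
        using k by (simp add: linear_sum[OF lin(1)] linear_cmul[OF lin(1)] linear_0[OF lin(2)])
      then have "(\<Sum>b\<in>Basis. k b *\<^sub>R b) = (0::'d)"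
        by (simp add: source.components_coord_field[OF c(1) q'])
      then show ?thesis by (metis inner_sum_left_Basis inner_zero_left)
    qed
    show "\<exists>k. tan_part q (W q) = (\<Sum>b\<in>Basis. k b *\<^sub>R coord_field A ?c b q)" if "q \<in> ?S" for q
      using source.coord_field_expansion[OF c(1)] that by blast
    show "smooth_fun_on A ?S (\<lambda>q. gM q (coord_field A ?c b q) (tan_part q (W q)))" for b
    proof -
      have "smooth_fun_on A ?S (\<lambda>q. g (f q) (W q) (df q (coord_field A ?c b q)))"
        using field_along_subset[OF W] by (intro smooth_metric_along[OF g oS(1)] field_along_pushforward oS e) auto
      then show ?thesis
        by (simp add: gM_tangential_part[symmetric] riemannian_sym[OF gM])
    qed
  qed
  with oS show "\<exists>N. open N \<and> p \<in> N \<and> vector_field_on A N (\<lambda>p. tan_part p (W p))" by blast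
qed

end

section \<open>Slant distributions\<close>

lemma riemannian_Cauchy_Schwarz:
  assumes g: "riemannian_metric A g"
  shows "\<bar>g p v w\<bar> \<le> sqrt (g p v v) * sqrt (g p w w)"
proof (cases "w = 0")
  case True
  then show ?thesis using linear_0[OF riemannian_linear_right[OF g]] by simp
next
  case False
  note lin = linear_diff[OF riemannian_linear_left[OF g]] linear_cmul[OF riemannian_linear_left[OF g]]
    linear_diff[OF riemannian_linear_right[OF g]] linear_cmul[OF riemannian_linear_right[OF g]]
  let ?u = "v - (g p v w / g p w w) *\<^sub>R w"
  have ww: "0 < g p w w" using riemannian_pos[OF g] False by blast
  have "0 \<le> g p ?u ?u" using riemannian_pos[OF g, of ?u p] riemannian_zero_iff[OF g, of p ?u] by (cases "?u = 0") auto
  also have "g p ?u ?u = g p v v - (g p v w)\<^sup>2 / g p w w"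
    using ww riemannian_sym[OF g, of p w v] by (simp add: lin power2_eq_square)
  finally have "(g p v w)\<^sup>2 \<le> g p v v * g p w w" using ww by (simp add: field_simps)
  then show ?thesis by (metis real_sqrt_abs real_sqrt_le_iff real_sqrt_mult)
qed

lemma (in manifold_map) field_along_endomorphism:
  assumes lin: "\<And>x. linear (\<phi> x)"
    and vf: "\<And>S X. open S \<Longrightarrow> vector_field_on B S X \<Longrightarrow> vector_field_on B S (\<lambda>x. \<phi> x (X x))"
    and S: "open S" and W: "field_along S W"
  shows "field_along S (\<lambda>q. \<phi> (f q) (W q))"
proof (rule field_along_local[OF S])
  fix p assume p: "p \<in> S"
  let ?c = "chart_at B (f p)"
  let ?S = "S \<inter> f -` chart_dom ?c"
  let ?w = "\<lambda>b q. components B ?c (f q) (W q) \<bullet> b" and ?e = "coord_field B ?c"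
  note c = target.chart_at[of "f p"]
  note T = target.open_chart_dom[OF c(1)]
  have oS: "open ?S" "p \<in> ?S" using S p c open_Int_vimage_chart by auto
  have pull: "field_along ?S (\<lambda>q. \<phi> (f q) (?e b (f q)))" for b
    using field_along_subset[OF field_along_pullback[OF T vf[OF T target.vector_field_coord_field[OF c(1)]]]] by simp
  have "field_along ?S (\<lambda>q. \<Sum>b\<in>Basis. ?w b q *\<^sub>R \<phi> (f q) (?e b (f q)))"
    by (intro field_along_sum_scaleR oS pull field_along_expansion(2)[OF c(1) W S])
  then have "field_along ?S (\<lambda>q. \<phi> (f q) (W q))"
  proof (rule field_along_cong[OF oS(1), rotated])
    show "(\<Sum>b\<in>Basis. ?w b q *\<^sub>R \<phi> (f q) (?e b (f q))) = \<phi> (f q) (W q)" if "q \<in> ?S" for q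
    proof -
      have "\<phi> (f q) (\<Sum>b\<in>Basis. ?w b q *\<^sub>R ?e b (f q)) = \<phi> (f q) (W q)"
        using field_along_expansion(1)[OF c(1) W, of q] that by simp
      then show ?thesis by (simp only: linear_sum[OF lin] linear_cmul[OF lin])
    qed
  qed
  with oS show "\<exists>N. open N \<and> p \<in> N \<and> field_along N (\<lambda>q. \<phi> (f q) (W q))" by blast
qed

locale bi_slant_immersion = map_to_affine A B f nabla + immersion A B f gM g
  for A :: "('a::{t2_space,second_countable_topology}, 'd::euclidean_space) chart set"
    and B :: "('m::{t2_space,second_countable_topology}, 'e::euclidean_space) chart set"
    and f :: "'a \<Rightarrow> 'm" and nabla :: "('m \<Rightarrow> 'e) \<Rightarrow> ('m \<Rightarrow> 'e) \<Rightarrow> 'm \<Rightarrow> 'e"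
    and gM :: "'a \<Rightarrow> 'd \<Rightarrow> 'd \<Rightarrow> real" and g :: "'m \<Rightarrow> 'e \<Rightarrow> 'e \<Rightarrow> real" +
  fixes \<phi> :: "'m \<Rightarrow> 'e \<Rightarrow> 'e" and \<xi> :: "'m \<Rightarrow> 'e" and \<eta> :: "'m \<Rightarrow> 'e \<Rightarrow> real"
    and D D1 D2 :: "'a \<Rightarrow> 'd set" and \<theta>1 \<theta>2 :: real
  assumes cosymplectic: "cosymplectic B \<phi> \<xi> \<eta> g nabla"
    and proper: "proper_quasi_bi_slant A gM B g f \<phi> \<xi> D D1 D2 \<theta>1 \<theta>2"
begin

lemma
  shows linear_phi: "linear (\<phi> x)"
    and phi_vf: "\<And>S X. open S \<Longrightarrow> vector_field_on B S X \<Longrightarrow> vector_field_on B S (\<lambda>x. \<phi> x (X x))"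
    and phi_phi: "\<phi> x (\<phi> x v) = - v + \<eta> x v *\<^sub>R \<xi> x"
    and eta_phi: "\<eta> x (\<phi> x v) = 0"
    and eta_xi: "\<eta> x (\<xi> x) = 1"
    and g_phi_phi: "g x (\<phi> x v) (\<phi> x w) = g x v w - \<eta> x v * \<eta> x w"
    and eta_eq: "\<eta> x v = g x v (\<xi> x)"
    and linear_eta: "linear (\<eta> x)"
proof -
  have acm: "almost_contact_metric B \<phi> \<xi> \<eta> g"
    using cosymplectic unfolding cosymplectic_def by (elim conjE)
  have "\<forall>p. linear (\<phi> p)" "\<forall>p. linear (\<eta> p)" "\<forall>p v. \<phi> p (\<phi> p v) = - v + \<eta> p v *\<^sub>R \<xi> p"
    "\<forall>S X. open S \<longrightarrow> vector_field_on B S X \<longrightarrow> vector_field_on B S (\<lambda>p. \<phi> p (X p))"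
    "\<forall>p v. \<eta> p (\<phi> p v) = 0" "\<forall>p. \<eta> p (\<xi> p) = 1"
    "\<forall>p v w. g p (\<phi> p v) (\<phi> p w) = g p v w - \<eta> p v * \<eta> p w" "\<forall>p v. \<eta> p v = g p v (\<xi> p)"
    using acm unfolding almost_contact_metric_def by - (elim conjE, assumption)+
  note * = this[rule_format]
  show "linear (\<phi> x)" "linear (\<eta> x)" "\<phi> x (\<phi> x v) = - v + \<eta> x v *\<^sub>R \<xi> x"
    "\<And>S X. open S \<Longrightarrow> vector_field_on B S X \<Longrightarrow> vector_field_on B S (\<lambda>x. \<phi> x (X x))"
    "\<eta> x (\<phi> x v) = 0" "\<eta> x (\<xi> x) = 1"
    "g x (\<phi> x v) (\<phi> x w) = g x v w - \<eta> x v * \<eta> x w" "\<eta> x v = g x v (\<xi> x)"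
    by (fact *)+
qed

lemma phi_parallel:
  "open S \<Longrightarrow> vector_field_on B S X \<Longrightarrow> vector_field_on B S Y \<Longrightarrow> x \<in> S \<Longrightarrow>
    nabla X (\<lambda>q. \<phi> q (Y q)) x = \<phi> x (nabla X Y x)"
proof -
  have "\<forall>S X Y. open S \<longrightarrow> vector_field_on B S X \<longrightarrow> vector_field_on B S Y \<longrightarrow>
        (\<forall>p\<in>S. nabla X (\<lambda>q. \<phi> q (Y q)) p - \<phi> p (nabla X Y p) = 0)"
    using cosymplectic unfolding cosymplectic_def by (elim conjE)
  from this[rule_format] show "open S \<Longrightarrow> vector_field_on B S X \<Longrightarrow> vector_field_on B S Y \<Longrightarrow> x \<in> S \<Longrightarrow>
    nabla X (\<lambda>q. \<phi> q (Y q)) x = \<phi> x (nabla X Y x)" by simp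
qed

lemmas phi_simps = linear_add[OF linear_phi] linear_diff[OF linear_phi] linear_cmul[OF linear_phi]
  linear_neg[OF linear_phi] linear_0[OF linear_phi]

lemma phi_skew: "g x (\<phi> x v) w = - g x v (\<phi> x w)"
proof -
  have "g x (\<phi> x v) (\<phi> x (\<phi> x w)) = g x v (\<phi> x w)"
    by (simp add: g_phi_phi eta_phi)
  then show ?thesis
    by (simp add: phi_phi g_simps eta_eq[symmetric] eta_phi)
qed

lemma
  shows xi_tangent: "\<xi> (f p) \<in> range (df p)"
    and dist_D1: "\<exists>k. distribution A k D1"
    and decomp: "\<exists>x\<in>D p. \<exists>y\<in>D1 p. \<exists>z\<in>D2 p. \<exists>t\<in>xi_line A B f \<xi> p. X = x + y + z + t"
    and D_D1: "x \<in> D p \<Longrightarrow> y \<in> D1 p \<Longrightarrow> gM p x y = 0"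
    and D_D2: "x \<in> D p \<Longrightarrow> z \<in> D2 p \<Longrightarrow> gM p x z = 0"
    and D1_D2: "y \<in> D1 p \<Longrightarrow> z \<in> D2 p \<Longrightarrow> gM p y z = 0"
    and D_xi: "x \<in> D p \<Longrightarrow> t \<in> xi_line A B f \<xi> p \<Longrightarrow> gM p x t = 0"
    and D1_xi: "y \<in> D1 p \<Longrightarrow> t \<in> xi_line A B f \<xi> p \<Longrightarrow> gM p y t = 0"
    and D2_xi: "z \<in> D2 p \<Longrightarrow> t \<in> xi_line A B f \<xi> p \<Longrightarrow> gM p z t = 0"
    and phi_D: "\<phi> (f p) ` df p ` D p = df p ` D p"
    and phi_D1_D2: "y \<in> D1 p \<Longrightarrow> z \<in> D2 p \<Longrightarrow> g (f p) (\<phi> (f p) (df p y)) (df p z) = 0"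
    and slant_D1: "y \<in> D1 p \<Longrightarrow> y \<noteq> 0 \<Longrightarrow> angle_to_subspace (g (f p)) (\<phi> (f p) (df p y)) (df p ` D1 p) = \<theta>1"
    and D1_nonzero: "D1 p \<noteq> {0}"
    and theta1: "\<theta>1 \<noteq> 0"
proof -
  have q: "quasi_bi_slant A gM B g f \<phi> \<xi> D D1 D2 \<theta>1 \<theta>2" and nz: "\<forall>p. D p \<noteq> {0} \<and> D1 p \<noteq> {0} \<and> D2 p \<noteq> {0}"
    and th: "\<theta>1 \<notin> {0, pi / 2}"
    using proper unfolding proper_quasi_bi_slant_def by - (elim conjE, assumption)+
  have "\<forall>p. \<xi> (f p) \<in> range (df p)" "\<exists>k. distribution A k D1"
    "\<forall>p X. \<exists>x\<in>D p. \<exists>y\<in>D1 p. \<exists>z\<in>D2 p. \<exists>t\<in>xi_line A B f \<xi> p. X = x + y + z + t"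
    "\<forall>p. \<phi> (f p) ` df p ` D p = df p ` D p"
    using q unfolding quasi_bi_slant_def by - (elim conjE, assumption)+
  note 1 = this[rule_format]
  show "\<xi> (f p) \<in> range (df p)" "\<exists>k. distribution A k D1"
    "\<exists>x\<in>D p. \<exists>y\<in>D1 p. \<exists>z\<in>D2 p. \<exists>t\<in>xi_line A B f \<xi> p. X = x + y + z + t"
    "\<phi> (f p) ` df p ` D p = df p ` D p"
    by (fact 1)+
  show "D1 p \<noteq> {0}" "\<theta>1 \<noteq> 0" using nz th by auto
  have orth: "\<forall>p. orthogonal_spaces (gM p) (D p) (D1 p) \<and>
          orthogonal_spaces (gM p) (D p) (D2 p) \<and>
          orthogonal_spaces (gM p) (D1 p) (D2 p) \<and>
          orthogonal_spaces (gM p) (D p) (xi_line A B f \<xi> p) \<and>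
          orthogonal_spaces (gM p) (D1 p) (xi_line A B f \<xi> p) \<and>
          orthogonal_spaces (gM p) (D2 p) (xi_line A B f \<xi> p)"
    and phi12: "\<forall>p. orthogonal_spaces (g (f p)) (\<phi> (f p) ` df p ` D1 p) (df p ` D2 p)"
    and sl: "slant A B g f \<phi> D1 \<theta>1"
    using q unfolding quasi_bi_slant_def by - (elim conjE, assumption)+
  show "x \<in> D p \<Longrightarrow> y \<in> D1 p \<Longrightarrow> gM p x y = 0"
   "x \<in> D p \<Longrightarrow> z \<in> D2 p \<Longrightarrow> gM p x z = 0"
   "y \<in> D1 p \<Longrightarrow> z \<in> D2 p \<Longrightarrow> gM p y z = 0"
   "x \<in> D p \<Longrightarrow> t \<in> xi_line A B f \<xi> p \<Longrightarrow> gM p x t = 0"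
   "y \<in> D1 p \<Longrightarrow> t \<in> xi_line A B f \<xi> p \<Longrightarrow> gM p y t = 0"
   "z \<in> D2 p \<Longrightarrow> t \<in> xi_line A B f \<xi> p \<Longrightarrow> gM p z t = 0"
    using orth unfolding orthogonal_spaces_def by blast+
  show "y \<in> D1 p \<Longrightarrow> z \<in> D2 p \<Longrightarrow> g (f p) (\<phi> (f p) (df p y)) (df p z) = 0"
    using phi12 unfolding orthogonal_spaces_def by blast
  show "y \<in> D1 p \<Longrightarrow> y \<noteq> 0 \<Longrightarrow> angle_to_subspace (g (f p)) (\<phi> (f p) (df p y)) (df p ` D1 p) = \<theta>1"
    using sl by (simp add: slant_def)
qed

lemma subspace_D1: "subspace (D1 p)"
  using dist_D1 by (auto simp: distribution_def)

lemma subspace_D: "subspace (D p)" and subspace_D2: "subspace (D2 p)"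
  using proper by (auto simp: proper_quasi_bi_slant_def quasi_bi_slant_def distribution_def)

lemma eta_df_D1: "y \<in> D1 p \<Longrightarrow> \<eta> (f p) (df p y) = 0"
proof -
  assume y: "y \<in> D1 p"
  obtain t where t: "\<xi> (f p) = df p t" using xi_tangent[of p] by blast
  then have "t \<in> xi_line A B f \<xi> p" by (simp add: xi_line_def span_base)
  from D1_xi[OF y this] t show ?thesis by (simp add: isometric eta_eq)
qed

lemma mem_D1I:
  assumes "\<And>x. x \<in> D p \<Longrightarrow> gM p X x = 0" "\<And>z. z \<in> D2 p \<Longrightarrow> gM p X z = 0"
    "\<And>t. t \<in> xi_line A B f \<xi> p \<Longrightarrow> gM p X t = 0"
  shows "X \<in> D1 p"
proof -
  obtain x y z t where X: "x \<in> D p" "y \<in> D1 p" "z \<in> D2 p" "t \<in> xi_line A B f \<xi> p" "X = x + y + z + t"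
    using decomp[of p X] by blast
  note s = riemannian_sym[OF gM]
  have "gM p x x = 0" using assms(1)[OF X(1)] D_D1[OF X(1,2)] D_D2[OF X(1,3)] D_xi[OF X(1,4)]
    s[of p y x] s[of p z x] s[of p t x] X(5) by (simp add: gM_simps)
  moreover have "gM p z z = 0" using assms(2)[OF X(3)] D1_D2[OF X(2,3)] D_D2[OF X(1,3)] D2_xi[OF X(3,4)]
    s[of p t z] X(5) by (simp add: gM_simps)
  moreover have "gM p t t = 0" using assms(3)[OF X(4)] D1_xi[OF X(2,4)] D_xi[OF X(1,4)] D2_xi[OF X(3,4)]
     X(5) by (simp add: gM_simps)
  ultimately show ?thesis using X by (simp add: riemannian_zero_iff[OF gM])
qed

abbreviation TT :: "'a \<Rightarrow> 'd \<Rightarrow> 'd" where "TT p X \<equiv> tan_part p (\<phi> (f p) (df p X))"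

lemma linear_TT: "linear (TT p)"
  using linear_compose[OF linear_compose[OF linear_df linear_phi] linear_tangential_part] by (simp add: o_def)

lemma phi_df_D:
  assumes "x \<in> D p"
  obtains x' where "x' \<in> D p" "\<phi> (f p) (df p x) = df p x'"
  using phi_D[of p] assms by blast

lemma gM_TT: "gM p (TT p X) Y = g (f p) (\<phi> (f p) (df p X)) (df p Y)"
  by (rule gM_tangential_part)

lemma gM_TT_skew: "gM p (TT p X) Y = - gM p X (TT p Y)"
  by (simp add: gM_TT phi_skew[of _ "df p X"] riemannian_sym[OF gM, of p X] riemannian_sym[OF g, of _ "df p X"])

lemma TT_D1: assumes y: "y \<in> D1 p" shows "TT p y \<in> D1 p"
proof (rule mem_D1I)
  show "gM p (TT p y) x = 0" if x: "x \<in> D p" for x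
  proof -
    obtain x' where x': "x' \<in> D p" "\<phi> (f p) (df p x) = df p x'" by (rule phi_df_D[OF x])
    then show ?thesis
      using D_D1[OF x'(1) y] riemannian_sym[OF gM, of p x' y] by (simp add: gM_TT phi_skew isometric[symmetric])
  qed
  show "gM p (TT p y) z = 0" if "z \<in> D2 p" for z
    using phi_D1_D2[OF y that] by (simp add: gM_TT)
  show "gM p (TT p y) t = 0" if t: "t \<in> xi_line A B f \<xi> p" for t
  proof -
    obtain r where "df p t = r *\<^sub>R \<xi> (f p)" using t by (auto simp: xi_line_def span_singleton)
    then show ?thesis by (simp add: gM_TT g_simps eta_eq[symmetric] eta_phi)
  qed
qed

lemma slant_angle:
  assumes y: "y \<in> D1 p" "y \<noteq> 0"
  shows "gM p (TT p y) (TT p y) = (cos \<theta>1)\<^sup>2 * gM p y y" "0 \<le> \<theta>1" "\<theta>1 \<le> pi / 2"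
proof -
  let ?v = "\<phi> (f p) (df p y)" and ?n = "\<lambda>X. sqrt (gM p X X)"
  define r where "r = ?n (TT p y) / ?n y"
  have gMnn: "0 \<le> gM p X X" for X
    using riemannian_pos[OF gM, of X p] riemannian_zero_iff[OF gM, of p X] by (cases "X = 0") auto
  have vv: "g (f p) ?v ?v = gM p y y"
    by (simp add: g_phi_phi eta_df_D1[OF y(1)] isometric)
  have ny: "0 < ?n y" using riemannian_pos[OF gM y(2)] by simp
  have CS: "\<bar>g (f p) ?v (df p w)\<bar> \<le> ?n (TT p y) * ?n w" for w
    using riemannian_Cauchy_Schwarz[OF gM, of p "TT p y" w] by (simp add: gM_TT)
  have "(?n (TT p y))\<^sup>2 = g (f p) ?v (df p (TT p y))"
    using gMnn by (simp add: gM_TT[symmetric])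
  also have "\<dots> \<le> ?n y * ?n (TT p y)"
    using riemannian_Cauchy_Schwarz[OF g, of "f p" ?v "df p (TT p y)"] by (simp add: vv isometric[symmetric])
  finally have "?n (TT p y) \<le> ?n y"
    unfolding power2_eq_square
    by (cases "0 < ?n (TT p y)") (use ny in \<open>auto simp only: mult_le_cancel_right_pos not_less intro: order_trans less_imp_le\<close>)
  then have r: "0 \<le> r" "r \<le> 1" using ny gMnn by (simp_all add: r_def)
  have ratio: "\<bar>g (f p) ?v (df p w) / (sqrt (g (f p) ?v ?v) * sqrt (g (f p) (df p w) (df p w)))\<bar> \<le> r" if "w \<noteq> 0" for w
  proof -
    have "0 < ?n w" using riemannian_pos[OF gM that] by simp
    then show ?thesis using CS[of w] ny by (simp add: r_def vv isometric[symmetric] field_simps)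
  qed
  have inj: "df p w \<noteq> 0" if "w \<noteq> 0" for w
    using riemannian_pos[OF gM that, of p] by (auto simp: isometric g_simps)
  have "angle_to_subspace (g (f p)) ?v (df p ` D1 p) = arccos r"
    unfolding angle_to_subspace_def
  proof (rule cInf_eq_minimum)
    define w where "w = (if TT p y = 0 then y else TT p y)"
    have w: "w \<in> D1 p" "w \<noteq> 0" using y TT_D1 by (auto simp: w_def)
    have "angle_between (g (f p)) ?v (df p w) = arccos r"
    proof (cases "TT p y = 0")
      case True
      then have "g (f p) ?v (df p y) = 0" using gM_TT[of p y y] by (simp add: gM_simps)
      then show ?thesis using True by (simp add: angle_between_def w_def r_def gM_simps)
    next
      case False
      then have "0 < gM p (TT p y) (TT p y)" by (rule riemannian_pos[OF gM])
      have "gM p (TT p y) (TT p y) / (?n y * ?n (TT p y)) = gM p (TT p y) (TT p y) / ?n (TT p y) / ?n y"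
        by (simp add: mult.commute)
      also have "\<dots> = r" using \<open>0 < gM p (TT p y) (TT p y)\<close> by (simp add: r_def real_div_sqrt)
      finally have "gM p (TT p y) (TT p y) / (?n y * ?n (TT p y)) = r" .
      then show ?thesis using False by (simp add: angle_between_def w_def vv isometric[symmetric] gM_TT[symmetric])
    qed
    then show "arccos r \<in> angle_between (g (f p)) ?v ` (df p ` D1 p - {0})"
      using w inj by force
    fix a assume "a \<in> angle_between (g (f p)) ?v ` (df p ` D1 p - {0})"
    then obtain w' where w'0: "df p w' \<noteq> 0" "a = angle_between (g (f p)) ?v (df p w')" by auto
    then have w': "w' \<noteq> 0" "a = angle_between (g (f p)) ?v (df p w')" by (auto simp: df_simps)
    show "arccos r \<le> a"
      unfolding w'(2) angle_between_def using ratio[OF w'(1)] r by (intro arccos_le_arccos) linarith+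
  qed
  with slant_D1[OF y] have th: "\<theta>1 = arccos r" by simp
  then have "cos \<theta>1 = r" using r by simp
  then have "?n (TT p y) = cos \<theta>1 * ?n y" using ny by (simp add: r_def)
  then have "(?n (TT p y))\<^sup>2 = (cos \<theta>1)\<^sup>2 * (?n y)\<^sup>2" by (simp add: power_mult_distrib)
  then show "gM p (TT p y) (TT p y) = (cos \<theta>1)\<^sup>2 * gM p y y" using gMnn by simp
  show "0 \<le> \<theta>1" "\<theta>1 \<le> pi / 2"
    using th r arccos_lbound[of r] arccos_le_pi2[of r] by auto
qed

lemma cos_theta1: "(cos \<theta>1)\<^sup>2 \<noteq> 1"
proof -
  obtain y where "y \<in> D1 undefined" "y \<noteq> 0"
    using D1_nonzero[of undefined] subspace_0[OF subspace_D1] by blast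
  from slant_angle(2,3)[OF this] theta1 have "0 < sin \<theta>1" by (intro sin_gt_zero) auto
  then have "0 < (sin \<theta>1)\<^sup>2" by simp
  then show ?thesis by (simp add: sin_squared_eq)
qed

lemma TT_TT:
  assumes y: "y \<in> D1 p"
  shows "TT p (TT p y) = - ((cos \<theta>1)\<^sup>2) *\<^sub>R y"
proof -
  let ?c = "(cos \<theta>1)\<^sup>2"
  have q: "gM p (TT p x) (TT p x) = ?c * gM p x x" if "x \<in> D1 p" for x
    using slant_angle(1)[OF that] by (cases "x = 0") (simp_all add: gM_simps linear_0[OF linear_TT])
  have polar: "gM p (TT p x) (TT p y) = ?c * gM p x y" if x: "x \<in> D1 p" for x
    using q[OF subspace_add[OF subspace_D1 x y]] q[OF x] q[OF y] riemannian_sym[OF gM, of p y x]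
      riemannian_sym[OF gM, of p "TT p y" "TT p x"]
    by (simp add: linear_add[OF linear_TT] gM_simps algebra_simps)
  let ?z = "TT p (TT p y) + ?c *\<^sub>R y"
  have z: "?z \<in> D1 p"
    using TT_D1 y by (intro subspace_add subspace_scale subspace_D1) auto
  have "gM p ?z ?z = 0"
    using polar[OF z] gM_TT_skew[of p ?z "TT p y"] by (simp add: gM_simps)
  then have "?z = 0" by (simp add: riemannian_zero_iff[OF gM])
  then show ?thesis by (simp add: eq_neg_iff_add_eq_0)
qed

end

section \<open>Totally geodesic slant foliations\<close>

context bi_slant_immersion
begin

lemma covd_phi:
  "field_along UNIV W \<Longrightarrow> covd U (\<lambda>q. \<phi> (f q) (W q)) p = \<phi> (f p) (covd U W p)"
  by (rule deriv_along_parallel[OF linear_phi phi_vf phi_parallel open_UNIV UNIV_I])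

lemma field_along_phi: "field_along UNIV W \<Longrightarrow> field_along UNIV (\<lambda>q. \<phi> (f q) (W q))"
  by (rule field_along_endomorphism[OF linear_phi phi_vf open_UNIV])

abbreviation T_field :: "('a \<Rightarrow> 'd) \<Rightarrow> 'a \<Rightarrow> 'd" where "T_field \<equiv> phi_T A B g f \<phi>"
abbreviation F_field :: "('a \<Rightarrow> 'd) \<Rightarrow> 'a \<Rightarrow> 'e" where "F_field \<equiv> phi_F A B g f \<phi>"
abbreviation shape :: "('a \<Rightarrow> 'e) \<Rightarrow> ('a \<Rightarrow> 'd) \<Rightarrow> 'a \<Rightarrow> 'd" where "shape \<equiv> shape_operator A B g f nabla"
abbreviation nconn :: "('a \<Rightarrow> 'd) \<Rightarrow> ('a \<Rightarrow> 'e) \<Rightarrow> 'a \<Rightarrow> 'e" where "nconn \<equiv> normal_connection A B g f nabla"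

lemma
  assumes V: "vector_field_on A UNIV V"
  shows field_along_df: "field_along UNIV (\<lambda>q. df q (V q))"
    and vector_field_T: "vector_field_on A UNIV (T_field V)"
    and field_along_F: "field_along UNIV (F_field V)"
    and phi_df_split: "\<phi> (f q) (df q (V q)) = df q (T_field V q) + F_field V q"
proof -
  show 1: "field_along UNIV (\<lambda>q. df q (V q))" by (rule field_along_pushforward[OF open_UNIV V])
  show 2: "vector_field_on A UNIV (T_field V)"
    unfolding phi_T_def[abs_def] by (rule vector_field_tangential_part[OF open_UNIV field_along_phi[OF 1]])
  have "field_along UNIV (\<lambda>q. \<phi> (f q) (df q (V q)) - df q (T_field V q))"
    by (intro field_along_diff open_UNIV field_along_phi 1 field_along_pushforward 2)
  then show "field_along UNIV (F_field V)"
    by (simp add: phi_F_def[abs_def] phi_T_def normal_part_def)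
  show "\<phi> (f q) (df q (V q)) = df q (T_field V q) + F_field V q"
    by (simp add: phi_F_def phi_T_def normal_part_def)
qed

lemma covd_phi_df:
  assumes V: "vector_field_on A UNIV V"
  shows "\<phi> (f p) (covd U (\<lambda>q. df q (V q)) p) = covd U (\<lambda>q. df q (T_field V q)) p + covd U (F_field V) p"
proof -
  have "\<phi> (f p) (covd U (\<lambda>q. df q (V q)) p) = covd U (\<lambda>q. df q (T_field V q) + F_field V q) p"
    by (simp only: covd_phi[OF field_along_df[OF V], symmetric] phi_df_split[OF V])
  then show ?thesis
    by (simp add: deriv_along_add[OF open_UNIV UNIV_I field_along_df[OF vector_field_T[OF V]] field_along_F[OF V]])
qed

lemma sections_D1D: "V \<in> sections A D1 \<Longrightarrow> vector_field_on A UNIV V" "V \<in> sections A D1 \<Longrightarrow> V p \<in> D1 p"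
  by (auto simp: sections_def)

lemma phi_phi_covd:
  assumes V: "V \<in> sections A D1"
  shows "\<phi> (f p) (\<phi> (f p) (covd U (\<lambda>q. df q (V q)) p)) = - covd U (\<lambda>q. df q (V q)) p"
proof -
  note Vs = sections_D1D[OF V]
  have "\<phi> (f p) (\<phi> (f p) (covd U (\<lambda>q. df q (V q)) p)) = covd U (\<lambda>q. \<phi> (f q) (\<phi> (f q) (df q (V q)))) p"
    by (simp only: covd_phi field_along_phi field_along_df[OF Vs(1)])
  also have "\<dots> = covd U (\<lambda>q. (-1) *\<^sub>R df q (V q)) p"
    by (simp add: phi_phi eta_df_D1[OF Vs(2)])
  also have "\<dots> = (-1) *\<^sub>R covd U (\<lambda>q. df q (V q)) p"
    by (rule deriv_along_scaleR[OF open_UNIV UNIV_I field_along_df[OF Vs(1)]])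
  finally show ?thesis by simp
qed

lemma eta_covd:
  assumes V: "V \<in> sections A D1"
  shows "\<eta> (f p) (covd U (\<lambda>q. df q (V q)) p) = 0"
proof -
  let ?W = "covd U (\<lambda>q. df q (V q)) p"
  have "\<eta> (f p) ?W *\<^sub>R \<xi> (f p) = 0"
    using phi_phi_covd[OF V, of p U] phi_phi[of "f p" ?W] by simp
  then have "\<eta> (f p) ?W * \<eta> (f p) (\<xi> (f p)) = 0"
    by (metis linear_0[OF linear_eta] linear_cmul[OF linear_eta] real_scaleR_def)
  then show ?thesis by (simp add: eta_xi)
qed

text \<open>On \<open>\<D>\<^sub>1\<close> both \<open>\<phi>\<^sup>2 = - id\<close> and \<open>\<T>\<^sup>2 = - cos\<^sup>2 \<theta>\<^sub>1 id\<close>; comparing them through the parallel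
  \<open>\<phi>\<close> expresses the derivative of \<open>V\<close> by derivatives of normal fields only.\<close>

lemma sin_covd:
  assumes V: "V \<in> sections A D1"
  shows "(1 - (cos \<theta>1)\<^sup>2) *\<^sub>R covd U (\<lambda>q. df q (V q)) p =
    - covd U (F_field (T_field V)) p - \<phi> (f p) (covd U (F_field V) p)"
proof -
  note Vs = sections_D1D[OF V]
  let ?W = "covd U (\<lambda>q. df q (V q)) p" and ?c = "(cos \<theta>1)\<^sup>2"
  have TTV: "df q (T_field (T_field V) q) = (- ?c) *\<^sub>R df q (V q)" for q
    using TT_TT[OF Vs(2), of q] by (simp add: phi_T_def df_simps)
  have "- ?W = \<phi> (f p) (covd U (\<lambda>q. df q (T_field V q)) p) + \<phi> (f p) (covd U (F_field V) p)"
    by (simp add: phi_phi_covd[OF V, symmetric] covd_phi_df[OF Vs(1)] phi_simps)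
  also have "\<phi> (f p) (covd U (\<lambda>q. df q (T_field V q)) p) = (- ?c) *\<^sub>R ?W + covd U (F_field (T_field V)) p"
    by (simp only: covd_phi_df[OF vector_field_T[OF Vs(1)]] TTV
        deriv_along_scaleR[OF open_UNIV UNIV_I field_along_df[OF Vs(1)]])
  finally show ?thesis by (simp add: algebra_simps)
qed

lemma covd_gauss_weingarten: "covd U N p = - df p (shape N U p) + nconn U N p"
  by (simp add: shape_operator_def normal_connection_def normal_part_def df_simps)

lemma normal_part_covd:
  assumes V: "V \<in> sections A D1"
  shows "(1 - (cos \<theta>1)\<^sup>2) *\<^sub>R nor_part p (covd U (\<lambda>q. df q (V q)) p) =
    F_field (shape (F_field V) U) p - nconn U (F_field (T_field V)) p - phi_C A B g f \<phi> (nconn U (F_field V)) p"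
proof -
  note nl = linear_add[OF linear_normal_part] linear_diff[OF linear_normal_part] linear_neg[OF linear_normal_part]
  have "nor_part p (\<phi> (f p) (covd U (F_field V) p)) =
      - F_field (shape (F_field V) U) p + phi_C A B g f \<phi> (nconn U (F_field V)) p"
    by (simp add: covd_gauss_weingarten phi_simps nl phi_F_def phi_C_def)
  moreover have "nor_part p (covd U (F_field (T_field V)) p) = nconn U (F_field (T_field V)) p"
    by (simp add: normal_connection_def)
  ultimately show ?thesis
    using arg_cong[OF sin_covd[OF V, of U p], of "nor_part p"]
    by (simp only: linear_cmul[OF linear_normal_part] nl) simp
qed

lemma F_field_D: assumes "X p \<in> D p" shows "F_field X p = 0"
proof -
  obtain x' where "x' \<in> D p" "\<phi> (f p) (df p (X p)) = df p x'" by (rule phi_df_D[OF assms])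
  then show ?thesis by (simp add: phi_F_def normal_part_df)
qed

lemma orth_proj_unique:
  assumes "subspace (E p)" "x \<in> E p" "\<And>z. z \<in> E p \<Longrightarrow> gM p (X p - x) z = 0"
  shows "orth_proj gM E X p = x"
  unfolding orth_proj_def
proof (rule the_equality)
  fix y assume y: "y \<in> E p \<and> (\<forall>z\<in>E p. gM p (X p - y) z = 0)"
  have "y - x \<in> E p" using assms(1,2) y by (simp add: subspace_diff)
  then have "gM p (X p - x) (y - x) = 0" "gM p (X p - y) (y - x) = 0"
    using assms(3) y by auto
  then have "gM p (y - x) (y - x) = 0" by (simp add: gM_simps)
  then show "y = x" by (simp add: riemannian_zero_iff[OF gM])
qed (use assms in auto)

lemma tangential_part_covd:
  assumes V: "V \<in> sections A D1" and Z: "Z p \<in> sum_spaces D D2 p"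
  shows "(1 - (cos \<theta>1)\<^sup>2) * g (f p) (covd U (\<lambda>q. df q (V q)) p) (df p (Z p)) =
    gM p (shape (F_field (T_field V)) U p) (Z p) - gM p (shape (F_field V) U p) (T_field (orth_proj gM D Z) p)
    - gM p (shape (F_field V) U p) (T_field (orth_proj gM D2 Z) p)
    + g (f p) (nconn U (F_field V) p) (F_field (orth_proj gM D2 Z) p)"
proof -
  let ?P = "orth_proj gM D Z" and ?R = "orth_proj gM D2 Z"
  let ?S = "\<lambda>N. shape N U p"
  obtain x z where xz: "x \<in> D p" "z \<in> D2 p" "Z p = x + z" using Z by (auto simp: sum_spaces_def)
  have P: "?P p = x"
    using xz D_D2 riemannian_sym[OF gM, of p z] by (intro orth_proj_unique subspace_D) auto
  have R: "?R p = z"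
    using xz D_D2 by (intro orth_proj_unique subspace_D2) auto
  have phiZ: "\<phi> (f p) (df p (Z p)) = df p (T_field ?P p) + df p (T_field ?R p) + F_field ?R p"
  proof -
    have "\<phi> (f p) (df p (Z p)) = \<phi> (f p) (df p (?P p)) + \<phi> (f p) (df p (?R p))"
      by (simp add: xz P R df_simps phi_simps)
    moreover have "\<phi> (f p) (df p (X p)) = df p (T_field X p) + F_field X p" for X
      by (simp add: phi_T_def phi_F_def normal_part_def)
    moreover have "F_field ?P p = 0" using F_field_D[of ?P] P xz by simp
    ultimately show ?thesis by simp
  qed
  have tan: "g (f p) (covd U N p) (df p w) = - gM p (?S N) w" for N w
    by (simp add: shape_operator_def gM_simps gM_tangential_part)
  have nor: "g (f p) (covd U N p) (F_field X p) = g (f p) (nconn U N p) (F_field X p)" for N X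
    using normal_part_orthogonal[of p "\<phi> (f p) (df p (X p))" "?S N"]
      riemannian_sym[OF g, of "f p" "df p (?S N)"]
    by (simp add: covd_gauss_weingarten g_simps phi_F_def)
  have "(1 - (cos \<theta>1)\<^sup>2) * g (f p) (covd U (\<lambda>q. df q (V q)) p) (df p (Z p)) =
     g (f p) (- covd U (F_field (T_field V)) p - \<phi> (f p) (covd U (F_field V) p)) (df p (Z p))"
    by (simp only: sin_covd[OF V, symmetric] g_simps real_scaleR_def)
  also have "\<dots> = gM p (?S (F_field (T_field V))) (Z p) + g (f p) (covd U (F_field V) p) (\<phi> (f p) (df p (Z p)))"
    by (simp add: g_simps tan phi_skew)
  also have "\<dots> = gM p (?S (F_field (T_field V))) (Z p) - gM p (?S (F_field V)) (T_field ?P p)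
    - gM p (?S (F_field V)) (T_field ?R p) + g (f p) (nconn U (F_field V) p) (F_field ?R p)"
    by (simp add: phiZ g_simps tan nor)
  finally show ?thesis .
qed

definition tangency_condition :: "('a \<Rightarrow> 'd) \<Rightarrow> ('a \<Rightarrow> 'd) \<Rightarrow> ('a \<Rightarrow> 'd) \<Rightarrow> 'a \<Rightarrow> bool" where
  "tangency_condition U V Z p \<longleftrightarrow>
   gM p (shape (F_field (T_field V)) U p) (Z p) - gM p (shape (F_field V) U p) (T_field (orth_proj gM D Z) p) =
   gM p (shape (F_field V) U p) (T_field (orth_proj gM D2 Z) p)
   - g (f p) (nconn U (F_field V) p) (F_field (orth_proj gM D2 Z) p)"

definition normal_defect :: "('a \<Rightarrow> 'd) \<Rightarrow> ('a \<Rightarrow> 'd) \<Rightarrow> 'a \<Rightarrow> 'e" where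
  "normal_defect U V p = F_field (shape (F_field V) U) p - nconn U (F_field (T_field V)) p
     - phi_C A B g f \<phi> (nconn U (F_field V)) p"

lemma tangency_condition_iff:
  assumes "V \<in> sections A D1" "Z p \<in> sum_spaces D D2 p"
  shows "tangency_condition U V Z p \<longleftrightarrow> g (f p) (covd U (\<lambda>q. df q (V q)) p) (df p (Z p)) = 0"
proof -
  have "tangency_condition U V Z p \<longleftrightarrow> (1 - (cos \<theta>1)\<^sup>2) * g (f p) (covd U (\<lambda>q. df q (V q)) p) (df p (Z p)) = 0"
    unfolding tangency_condition_def tangential_part_covd[of V Z p U, OF assms] by auto
  then show ?thesis using cos_theta1 by auto
qed

lemma normal_defect_tangent_iff:
  assumes V: "V \<in> sections A D1"
  shows "along_in_sections A B f (\<lambda>p. UNIV) (normal_defect U V) \<longleftrightarrow>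
    (\<forall>p. nor_part p (covd U (\<lambda>q. df q (V q)) p) = 0)"
proof -
  have eq: "normal_defect U V p = (1 - (cos \<theta>1)\<^sup>2) *\<^sub>R nor_part p (covd U (\<lambda>q. df q (V q)) p)" for p
    by (simp add: normal_defect_def normal_part_covd[OF V])
  show ?thesis
  proof
    assume "along_in_sections A B f (\<lambda>p. UNIV) (normal_defect U V)"
    then obtain Y where Y: "\<And>p. normal_defect U V p = df p (Y p)" by (auto simp: along_in_sections_def)
    show "\<forall>p. nor_part p (covd U (\<lambda>q. df q (V q)) p) = 0"
    proof
      fix p
      have "g (f p) (df p (Y p)) (df p (Y p)) = g (f p) (normal_defect U V p) (df p (Y p))"
        by (simp only: Y)
      also have "\<dots> = 0"
        by (simp only: eq g_simps real_scaleR_def normal_part_orthogonal mult_zero_right)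
      finally have "df p (Y p) = 0" by (simp add: riemannian_zero_iff[OF g])
      then show "nor_part p (covd U (\<lambda>q. df q (V q)) p) = 0" using eq[of p] Y[of p] cos_theta1 by auto
    qed
  next
    assume "\<forall>p. nor_part p (covd U (\<lambda>q. df q (V q)) p) = 0"
    then have "normal_defect U V p = df p 0" for p by (simp add: eq df_simps)
    moreover have "vector_field_on A UNIV (\<lambda>p. 0)"
      using source.vector_field_sum_scaleR[OF open_UNIV, of "{}"] by simp
    ultimately show "along_in_sections A B f (\<lambda>p. UNIV) (normal_defect U V)"
      unfolding along_in_sections_def sections_def by (intro bexI[of _ "\<lambda>p. 0"]) auto
  qed
qed

text \<open>The projection of a global field to \<open>\<D>\<oplus>\<D>\<^sub>2\<close> is itself a global test field \<open>Z\<close>, so that no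
  extension of tangent vectors by cut-off functions is needed.\<close>

lemma section_of_D1I:
  assumes Y: "vector_field_on A UNIV Y"
    and xi: "\<And>p t. t \<in> xi_line A B f \<xi> p \<Longrightarrow> gM p (Y p) t = 0"
    and Z: "\<And>Z. Z \<in> sections A (sum_spaces D D2) \<Longrightarrow> \<forall>p. gM p (Y p) (Z p) = 0"
  shows "Y \<in> sections A D1"
proof -
  have "\<exists>y. y \<in> D1 p \<and> Y p - y \<in> sum_spaces D D2 p \<and> (\<forall>w\<in>D1 p. gM p (Y p - y) w = 0)" for p
  proof -
    obtain x y z t where X: "x \<in> D p" "y \<in> D1 p" "z \<in> D2 p" "t \<in> xi_line A B f \<xi> p" "Y p = x + y + z + t"
      using decomp[of p "Y p"] by blast
    have "gM p t t = 0" using xi[OF X(4)] D1_xi[OF X(2,4)] D_xi[OF X(1,4)] D2_xi[OF X(3,4)] X(5)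
      by (simp add: gM_simps)
    then have "Y p - y = x + z" using X(5) by (simp add: riemannian_zero_iff[OF gM])
    then show ?thesis
      using X(1-3) D_D1 D1_D2 riemannian_sym[OF gM, of p z]
      by (intro exI[of _ y]) (auto simp: sum_spaces_def gM_simps)
  qed
  then obtain Q where Q: "\<And>p. Q p \<in> D1 p" "\<And>p. Y p - Q p \<in> sum_spaces D D2 p"
    "\<And>p w. w \<in> D1 p \<Longrightarrow> gM p (Y p - Q p) w = 0"
    by metis
  obtain k where "distribution A k D1" using dist_D1 by blast
  then have "vector_field_on A UNIV Q"
    by (rule source.vector_field_orthogonal_projection[OF gM _ Y Q(1,3)])
  then have "(\<lambda>p. Y p - Q p) \<in> sections A (sum_spaces D D2)"
    using Q(2) source.vector_field_diff[OF open_UNIV Y] by (simp add: sections_def)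
  from Z[OF this] have YZ: "gM p (Y p) (Y p - Q p) = 0" for p by blast
  have "gM p (Y p - Q p) (Y p - Q p) = 0" for p
    using YZ[of p] Q(3)[OF Q(1), of p] riemannian_sym[OF gM, of p "Q p" "Y p - Q p"]
    by (simp only: linear_diff[OF riemannian_linear_left[OF gM], of p _ _ "Y p - Q p"])
  then have "Y = Q" by (simp add: riemannian_zero_iff[OF gM] fun_eq_iff)
  then show ?thesis using Y Q(1) by (simp add: sections_def)
qed

lemma totally_geodesic_iff:
  "totally_geodesic_foliation A B f nabla D1 \<longleftrightarrow>
    (\<forall>U\<in>sections A D1. \<forall>V\<in>sections A D1. \<forall>Z\<in>sections A (sum_spaces D D2).
      (\<forall>p. tangency_condition U V Z p) \<and> along_in_sections A B f (\<lambda>p. UNIV) (normal_defect U V))"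
  (is "_ \<longleftrightarrow> ?cond")
proof
  assume tgf: "totally_geodesic_foliation A B f nabla D1"
  show ?cond
  proof (intro ballI)
    fix U V Z assume U: "U \<in> sections A D1" and V: "V \<in> sections A D1" and Z: "Z \<in> sections A (sum_spaces D D2)"
    obtain Y where Y: "Y \<in> sections A D1" "\<And>p. covd U (\<lambda>p. df p (V p)) p = df p (Y p)"
      using tgf U V unfolding totally_geodesic_foliation_def along_in_sections_def by blast
    have Zp: "Z p \<in> sum_spaces D D2 p" for p using Z by (simp add: sections_def)
    have "gM p (Y p) (Z p) = 0" for p
    proof -
      obtain x z where xz: "x \<in> D p" "z \<in> D2 p" "Z p = x + z" using Zp[of p] by (auto simp: sum_spaces_def)
      then show ?thesis
        using D_D1[OF xz(1) sections_D1D(2)[OF Y(1)]] D1_D2[OF sections_D1D(2)[OF Y(1)] xz(2)]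
          riemannian_sym[OF gM, of p x "Y p"]
        by (simp add: gM_simps)
    qed
    then have "tangency_condition U V Z p" for p
      by (simp add: tangency_condition_iff[OF V Zp] Y(2) isometric)
    moreover have "along_in_sections A B f (\<lambda>p. UNIV) (normal_defect U V)"
      by (simp add: normal_defect_tangent_iff[OF V] Y(2) normal_part_df)
    ultimately show "(\<forall>p. tangency_condition U V Z p) \<and> along_in_sections A B f (\<lambda>p. UNIV) (normal_defect U V)"
      by blast
  qed
next
  assume cond: ?cond
  show "totally_geodesic_foliation A B f nabla D1"
    unfolding totally_geodesic_foliation_def
  proof (intro ballI)
    fix U V assume U: "U \<in> sections A D1" and V: "V \<in> sections A D1"
    let ?W = "covd U (\<lambda>p. df p (V p))"
    define Y where "Y p = tan_part p (?W p)" for p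
    have Yvf: "vector_field_on A UNIV Y"
      unfolding Y_def[abs_def] using sections_D1D(1)[OF U] sections_D1D(1)[OF V]
      by (intro vector_field_tangential_part field_along_deriv_along field_along_df open_UNIV)
    have gMY: "gM p (Y p) w = g (f p) (?W p) (df p w)" for p w by (simp add: Y_def gM_tangential_part)
    have "Y \<in> sections A D1"
    proof (rule section_of_D1I[OF Yvf])
      fix p t assume "t \<in> xi_line A B f \<xi> p"
      then obtain r where "df p t = r *\<^sub>R \<xi> (f p)" by (auto simp: xi_line_def span_singleton)
      then show "gM p (Y p) t = 0"
        by (simp add: gMY g_simps eta_eq[symmetric] eta_covd[OF V])
    next
      fix Z assume Z: "Z \<in> sections A (sum_spaces D D2)"
      then have Zp: "Z p \<in> sum_spaces D D2 p" for p by (simp add: sections_def)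
      have "tangency_condition U V Z p" for p using cond U V Z by blast
      then have "gM p (Y p) (Z p) = 0" for p
        using tangency_condition_iff[OF V, of Z p U] Zp[of p] by (simp add: gMY)
      then show "\<forall>p. gM p (Y p) (Z p) = 0" ..
    qed
    moreover have "?W p = df p (Y p)" for p
    proof -
      have "(\<lambda>p. 0) \<in> sections A (sum_spaces D D2)"
        using source.vector_field_sum_scaleR[OF open_UNIV, of "{}"] subspace_0[OF subspace_D] subspace_0[OF subspace_D2]
        by (force simp: sections_def sum_spaces_def)
      then have "nor_part p (?W p) = 0"
        using cond U V normal_defect_tangent_iff[OF V] by blast
      then show ?thesis by (simp add: Y_def normal_part_def)
    qed
    ultimately show "along_in_sections A B f D1 ?W"
      by (auto simp: along_in_sections_def)
  qed
qed

end

theorem theorem4p5: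
  fixes A :: "('a::{t2_space,second_countable_topology}, 'd::euclidean_space) chart set"
    and B :: "('m::{t2_space,second_countable_topology}, 'e::euclidean_space) chart set"
    and gM :: "'a \<Rightarrow> 'd \<Rightarrow> 'd \<Rightarrow> real"
    and g :: "'m \<Rightarrow> 'e \<Rightarrow> 'e \<Rightarrow> real"
    and \<phi> :: "'m \<Rightarrow> 'e \<Rightarrow> 'e"
    and \<xi> :: "'m \<Rightarrow> 'e"
    and \<eta> :: "'m \<Rightarrow> 'e \<Rightarrow> real"
    and nabla :: "('m \<Rightarrow> 'e) \<Rightarrow> ('m \<Rightarrow> 'e) \<Rightarrow> 'm \<Rightarrow> 'e"
    and f :: "'a \<Rightarrow> 'm"
    and D D1 D2 :: "'a \<Rightarrow> 'd set"
    and \<theta>1 \<theta>2 :: real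
  assumes "cosymplectic B \<phi> \<xi> \<eta> g nabla"
    and "isometric_immersion A gM B g f"
    and "proper_quasi_bi_slant A gM B g f \<phi> \<xi> D D1 D2 \<theta>1 \<theta>2"
  shows
    "let \<T> = phi_T A B g f \<phi>;
         \<F> = phi_F A B g f \<phi>;
         \<C> = phi_C A B g f \<phi>;
         \<P> = orth_proj gM D;
         \<R> = orth_proj gM D2;
         \<A> = shape_operator A B g f nabla;
         nabla_perp = normal_connection A B g f nabla
     in totally_geodesic_foliation A B f nabla D1 \<longleftrightarrow>
        (\<forall>U\<in>sections A D1. \<forall>V\<in>sections A D1. \<forall>Z\<in>sections A (sum_spaces D D2).
           (\<forall>p. gM p (\<A> (\<F> (\<T> V)) U p) (Z p) - gM p (\<A> (\<F> V) U p) (\<T> (\<P> Z) p) =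
                gM p (\<A> (\<F> V) U p) (\<T> (\<R> Z) p)
                - g (f p) (nabla_perp U (\<F> V) p) (\<F> (\<R> Z) p)) \<and>
           along_in_sections A B f (\<lambda>p. UNIV)
             (\<lambda>p. \<F> (\<A> (\<F> V) U) p - nabla_perp U (\<F> (\<T> V)) p
                   - \<C> (nabla_perp U (\<F> V)) p))"
proof -
  have acm: "almost_contact_metric B \<phi> \<xi> \<eta> g" and lc: "levi_civita B g nabla"
    using assms(1) unfolding cosymplectic_def by - (elim conjE, assumption)+
  have B: "smooth_atlas B" "riemannian_metric B g"
    using acm unfolding almost_contact_metric_def by - (elim conjE, assumption)+
  have conn: "affine_connection B nabla"
    using lc unfolding levi_civita_def by (elim conjE)
  have M: "smooth_atlas A" "riemannian_metric A gM" "smooth_map A B f"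
    "\<forall>p u v. gM p u v = g (f p) (tangent_map A B f p u) (tangent_map A B f p v)"
    using assms(2) unfolding isometric_immersion_def by - (elim conjE, assumption)+
  interpret bi_slant_immersion A B f nabla gM g \<phi> \<xi> \<eta> D D1 D2 \<theta>1 \<theta>2
    by unfold_locales (fact B conn M(1-3) M(4)[rule_format] assms(1,3))+
  show ?thesis
    unfolding Let_def by (rule totally_geodesic_iff[unfolded tangency_condition_def normal_defect_def[abs_def]])
qed

end
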